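(* Let $\Phi$ be a commutative associative ring with $1$, let $R$ and $S$ be associative unital $\Phi$-algebras, and let $n\ge 3$. Suppose that $\varphi\colon T(R)\to T(S)$ is a Jordan isomorphism. Then there exist an idempotent $h\in\Phi$, an isomorphism $\psi_1\colon hR\to hS$, an antiisomorphism $\psi_2\colon(1-h)R\to(1-h)S$, and invertible elements $g_1\in UT(n,S)$ and $g_2\in\operatorname{Diag}(S^* )$ such that $$\varphi=\widehat g_1\,\widehat g_2\,(\widetilde\psi_1+\widetilde\psi_2);$$ that is, $\varphi(x)=\widehat g_1\bigl(\widehat g_2\bigl(\widetilde\psi_1(hx)+\widetilde\psi_2((1-h)x)\bigr)\bigr)$ for all $x\in T(R)$.
   Context: All algebras are over $\Phi$ and all maps are $\Phi$-linear. The algebras $R$ and $S$ are arbitrary associative unital $\Phi$-algebras, not necessarily commutative, with identity elements $1_R$ and $1_S$. A $\Phi$-linear map $\varphi\colon A\to B$ of associative algebras is a Jordan homomorphism if $\varphi(x^2)=\varphi(x)^2$ for all $x\in A$ and $\varphi(xyx)=\varphi(x)\varphi(y)\varphi(x)$ for all $x,y\in A$; a Jordan isomorphism is a bijective Jordan homomorphism. $T(R)$ is the associative $\Phi$-algebra of upper triangular $n\times n$ matrices with diagonal entries in $\Phi$ and entries strictly above the diagonal in $R$ (scalars from $\Phi$ multiply elements of $R$ through the $\Phi$-algebra structure). $T(S)$ is defined likewise. $e_{ij}(a)$ is the $n\times n$ matrix with $(i,j)$-entry $a$ and all other entries zero. For an idempotent $h\in\Phi$ (possibly $0$ or $1$),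 $hT(R)$ is the ideal of $T(R)$ of matrices with diagonal entries in $h\Phi$ and strictly upper entries in $hR$, and $T(R)=hT(R)\oplus(1-h)T(R)$. An antiisomorphism is a bijective $\Phi$-linear map $\chi$ with $\chi(xy)=\chi(y)\chi(x)$. An isomorphism $\psi\colon hR\to hS$ induces the isomorphism $\widetilde\psi\colon hT(R)\to hT(S)$ that applies $\psi$ to each entry, $(a_{ij})\mapsto(\psi(a_{ij}))$. An antiisomorphism $\psi\colon hR\to hS$ induces the antiisomorphism $\widetilde\psi\colon hT(R)\to hT(S)$, $e_{ij}(a)\mapsto e_{n+1-j,\,n+1-i}(\psi(a))$. In both cases scalars from $h\Phi$ on the diagonal are left unchanged by $\psi$. $UT(n,S)$ is the group of upper triangular $n\times n$ matrices with all diagonal entries $1_S$ and arbitrary entries from $S$ above the diagonal. $S^*$ is the group of invertible elements of $S$, and $\operatorname{Diag}(S^* )=\{\operatorname{diag}(u_1,\dots,u_n)\mid u_i\in S^*\}$. For $g$ in either group, $\widehat g$ is the automorphism $x\mapsto gxg^{-1}$ of $T(S)$.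
   Formalization: The formal theorem additionally assumes that no nonzero idempotent e of Φ satisfies eR = 0; without this the statement fails, since permuting the diagonal positions of eT(R) gives further Jordan automorphisms. *)

theory Defs
  imports "Jordan_Normal_Form.Matrix"
begin

text \<open>
  The sort \<open>{ring, monoid_mult}\<close> describes associative rings with identity in which \<open>0 = 1\<close> is
  permitted; \<open>ring_1\<close>, \<open>comm_ring_1\<close>, and hence the locale \<open>module\<close>, would exclude the zero ring.
\<close>

locale unital_algebra =
  fixes scale :: "'k :: {comm_ring, monoid_mult} \<Rightarrow> 'a :: {ring, monoid_mult} \<Rightarrow> 'a"
  assumes scale_add_right: "scale c (x + y) = scale c x + scale c y"
    and scale_add_left: "scale (c + d) x = scale c x + scale d x"
    and scale_scale: "scale c (scale d x) = scale (c * d) x"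
    and scale_one: "scale 1 x = x"
    and scale_mult_left: "scale c x * y = scale c (x * y)"
    and scale_mult_right: "x * scale c y = scale c (x * y)"

text \<open>
  An element of \<open>T(R)\<close> is stored as a pair: the vector of its diagonal entries, which are elements
  of \<open>\<Phi>\<close> itself and not of its image in \<open>R\<close>, and an \<open>R\<close>-matrix that vanishes on and below the
  diagonal. Indices run from \<open>0\<close> to \<open>n - 1\<close>.
\<close>

type_synonym ('k, 'a) tri = "'k vec \<times> 'a mat"

definition tri_carrier :: "nat \<Rightarrow> ('k, 'a :: zero) tri set" where
  "tri_carrier n = {(d, U). d \<in> carrier_vec n \<and> U \<in> carrier_mat n n \<and>
     (\<forall>i j. i < n \<longrightarrow> j \<le> i \<longrightarrow> U $$ (i, j) = 0)}"

definition tri_add :: "('k :: plus, 'a :: plus) tri \<Rightarrow> ('k, 'a) tri \<Rightarrow> ('k, 'a) tri" where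
  "tri_add x y = (fst x + fst y, snd x + snd y)"

definition tri_scale :: "('k \<Rightarrow> 'a \<Rightarrow> 'a) \<Rightarrow> 'k :: times \<Rightarrow> ('k, 'a) tri \<Rightarrow> ('k, 'a) tri" where
  "tri_scale scale c x = (c \<cdot>\<^sub>v fst x, map_mat (scale c) (snd x))"

definition strict_upper :: "nat \<Rightarrow> 'a :: zero mat \<Rightarrow> 'a mat" where
  "strict_upper n A = mat n n (\<lambda>(i, j). if i < j then A $$ (i, j) else 0)"

definition full_mat :: "('k \<Rightarrow> 'a \<Rightarrow> 'a) \<Rightarrow> nat \<Rightarrow> ('k, 'a :: {zero, one}) tri \<Rightarrow> 'a mat" where
  "full_mat scale n x = mat n n (\<lambda>(i, j). if i = j then scale (fst x $ i) 1 else snd x $$ (i, j))"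

text \<open>
  Matrix multiplication: above the diagonal the entries are those of the product of the
  corresponding \<open>R\<close>-matrices, while the diagonal entries are multiplied in \<open>\<Phi>\<close>.
\<close>

definition tri_mult ::
  "('k \<Rightarrow> 'a \<Rightarrow> 'a) \<Rightarrow> nat \<Rightarrow> ('k :: times, 'a :: {ring, monoid_mult}) tri \<Rightarrow> ('k, 'a) tri \<Rightarrow> ('k, 'a) tri"
  where
  "tri_mult scale n x y =
     (vec n (\<lambda>i. fst x $ i * fst y $ i), strict_upper n (full_mat scale n x * full_mat scale n y))"

lemma full_mat_index:
  "i < n \<Longrightarrow> j < n \<Longrightarrow>
   full_mat scale n x $$ (i, j) = (if i = j then scale (fst x $ i) 1 else snd x $$ (i, j))"
  by (simp add: full_mat_def)

lemma (in unital_algebra) full_mat_mult: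
  assumes x: "x \<in> tri_carrier n" and y: "y \<in> tri_carrier n"
  shows "full_mat scale n (tri_mult scale n x y) = full_mat scale n x * full_mat scale n y"
proof (rule eq_matI)
  fix i j
  assume "i < dim_row (full_mat scale n x * full_mat scale n y)"
    and "j < dim_col (full_mat scale n x * full_mat scale n y)"
  hence i: "i < n" and j: "j < n" by (auto simp: full_mat_def)
  define A where "A = full_mat scale n x"
  define B where "B = full_mat scale n y"
  have zA: "A $$ (i, k) = 0" if "k < i" for k
    using x i that by (auto simp: A_def full_mat_def tri_carrier_def)
  have zB: "B $$ (k, j) = 0" if "j < k" "k < n" for k
    using y j that by (auto simp: B_def full_mat_def tri_carrier_def)
  have s: "(A * B) $$ (i, j) = (\<Sum>k<n. A $$ (i, k) * B $$ (k, j))"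
    using i j by (simp add: A_def B_def full_mat_def scalar_prod_def lessThan_atLeast0)
  consider "i < j" | "i = j" | "j < i" by linarith
  hence "full_mat scale n (tri_mult scale n x y) $$ (i, j) = (A * B) $$ (i, j)"
  proof cases
    case 1
    then show ?thesis using i j
      by (simp add: full_mat_index tri_mult_def strict_upper_def A_def B_def del: index_mult_mat)
  next
    case 2
    have "A $$ (i, k) * B $$ (k, j) = 0" if "k \<in> {..<n} - {i}" for k
      using zA[of k] zB[of k] that 2 by (cases "k < i") auto
    hence "(\<Sum>k<n. A $$ (i, k) * B $$ (k, j)) = A $$ (i, i) * B $$ (i, i)"
      using i 2 by (subst sum.remove[of _ i]) auto
    then show ?thesis using s 2 i
      by (simp add: tri_mult_def full_mat_index A_def B_def scale_mult_left scale_scale)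
  next
    case 3
    have "A $$ (i, k) * B $$ (k, j) = 0" if "k \<in> {..<n}" for k
      using zA[of k] zB[of k] that 3 by (cases "k < i") auto
    hence "(A * B) $$ (i, j) = 0" using s by simp
    then show ?thesis using 3 i j
      by (simp add: full_mat_index tri_mult_def strict_upper_def)
  qed
  thus "full_mat scale n (tri_mult scale n x y) $$ (i, j) =
      (full_mat scale n x * full_mat scale n y) $$ (i, j)"
    by (simp add: A_def B_def)
qed (auto simp: full_mat_def)

definition tri_linear ::
  "('k \<Rightarrow> 'r \<Rightarrow> 'r) \<Rightarrow> ('k \<Rightarrow> 's \<Rightarrow> 's) \<Rightarrow> nat \<Rightarrow>
   (('k :: {plus, times}, 'r :: {zero, plus}) tri \<Rightarrow> ('k, 's :: plus) tri) \<Rightarrow> bool" where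
  "tri_linear scR scS n \<phi> \<longleftrightarrow>
     (\<forall>x \<in> tri_carrier n. \<forall>y \<in> tri_carrier n. \<phi> (tri_add x y) = tri_add (\<phi> x) (\<phi> y)) \<and>
     (\<forall>c. \<forall>x \<in> tri_carrier n. \<phi> (tri_scale scR c x) = tri_scale scS c (\<phi> x))"

definition jordan_hom ::
  "('k \<Rightarrow> 'r \<Rightarrow> 'r) \<Rightarrow> ('k \<Rightarrow> 's \<Rightarrow> 's) \<Rightarrow> nat \<Rightarrow>
   (('k :: {comm_ring, monoid_mult}, 'r :: {ring, monoid_mult}) tri \<Rightarrow>
    ('k, 's :: {ring, monoid_mult}) tri) \<Rightarrow> bool" where
  "jordan_hom scR scS n \<phi> \<longleftrightarrow>
     \<phi> ` tri_carrier n \<subseteq> tri_carrier n \<and> tri_linear scR scS n \<phi> \<and>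
     (\<forall>x \<in> tri_carrier n. \<phi> (tri_mult scR n x x) = tri_mult scS n (\<phi> x) (\<phi> x)) \<and>
     (\<forall>x \<in> tri_carrier n. \<forall>y \<in> tri_carrier n.
        \<phi> (tri_mult scR n (tri_mult scR n x y) x) =
        tri_mult scS n (tri_mult scS n (\<phi> x) (\<phi> y)) (\<phi> x))"

definition jordan_iso ::
  "('k \<Rightarrow> 'r \<Rightarrow> 'r) \<Rightarrow> ('k \<Rightarrow> 's \<Rightarrow> 's) \<Rightarrow> nat \<Rightarrow>
   (('k :: {comm_ring, monoid_mult}, 'r :: {ring, monoid_mult}) tri \<Rightarrow>
    ('k, 's :: {ring, monoid_mult}) tri) \<Rightarrow> bool" where
  "jordan_iso scR scS n \<phi> \<longleftrightarrow>
     jordan_hom scR scS n \<phi> \<and> bij_betw \<phi> (tri_carrier n) (tri_carrier n)"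

text \<open>The summands \<open>hR\<close> and \<open>hS\<close> are \<open>range (scR h)\<close> and \<open>range (scS h)\<close>.\<close>

definition linear_bij ::
  "('k \<Rightarrow> 'r \<Rightarrow> 'r) \<Rightarrow> ('k \<Rightarrow> 's \<Rightarrow> 's) \<Rightarrow> 'k \<Rightarrow> ('r :: plus \<Rightarrow> 's :: plus) \<Rightarrow> bool" where
  "linear_bij scR scS h \<psi> \<longleftrightarrow>
     bij_betw \<psi> (range (scR h)) (range (scS h)) \<and>
     (\<forall>a \<in> range (scR h). \<forall>b \<in> range (scR h). \<psi> (a + b) = \<psi> a + \<psi> b) \<and>
     (\<forall>c. \<forall>a \<in> range (scR h). \<psi> (scR c a) = scS c (\<psi> a))"

definition summand_iso ::
  "('k \<Rightarrow> 'r \<Rightarrow> 'r) \<Rightarrow> ('k \<Rightarrow> 's \<Rightarrow> 's) \<Rightarrow> 'k \<Rightarrow> ('r :: {plus, times} \<Rightarrow> 's :: {plus, times}) \<Rightarrow> bool"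
  where
  "summand_iso scR scS h \<psi> \<longleftrightarrow> linear_bij scR scS h \<psi> \<and>
     (\<forall>a \<in> range (scR h). \<forall>b \<in> range (scR h). \<psi> (a * b) = \<psi> a * \<psi> b)"

definition summand_antiiso ::
  "('k \<Rightarrow> 'r \<Rightarrow> 'r) \<Rightarrow> ('k \<Rightarrow> 's \<Rightarrow> 's) \<Rightarrow> 'k \<Rightarrow> ('r :: {plus, times} \<Rightarrow> 's :: {plus, times}) \<Rightarrow> bool"
  where
  "summand_antiiso scR scS h \<psi> \<longleftrightarrow> linear_bij scR scS h \<psi> \<and>
     (\<forall>a \<in> range (scR h). \<forall>b \<in> range (scR h). \<psi> (a * b) = \<psi> b * \<psi> a)"

definition lift_iso :: "('r \<Rightarrow> 's) \<Rightarrow> ('k, 'r) tri \<Rightarrow> ('k, 's) tri" where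
  "lift_iso \<psi> x = (fst x, map_mat \<psi> (snd x))"

text \<open>
  With indices starting at \<open>0\<close>, the unit \<open>e i j a\<close> is sent to \<open>e (n-1-j) (n-1-i) (\<psi> a)\<close>; the same
  rule with \<open>i = j\<close> reverses the diagonal.
\<close>

definition lift_antiiso :: "nat \<Rightarrow> ('r \<Rightarrow> 's) \<Rightarrow> ('k, 'r) tri \<Rightarrow> ('k, 's) tri" where
  "lift_antiiso n \<psi> x =
     (vec n (\<lambda>i. fst x $ (n - 1 - i)),
      mat n n (\<lambda>(i, j). \<psi> (snd x $$ (n - 1 - j, n - 1 - i))))"

definition UT :: "nat \<Rightarrow> 's :: {zero, one} mat set" where
  "UT n = {g \<in> carrier_mat n n. upper_triangular g \<and> (\<forall>i < n. g $$ (i, i) = 1)}"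

definition Diag_units :: "nat \<Rightarrow> 's :: {ring, monoid_mult} mat set" where
  "Diag_units n = {mat_diag n u | u. \<forall>i < n. \<exists>v. u i * v = 1 \<and> v * u i = 1}"

definition mat_inverse :: "nat \<Rightarrow> 's :: {ring, monoid_mult} mat \<Rightarrow> 's mat" where
  "mat_inverse n g = (THE g'. g' \<in> carrier_mat n n \<and> g * g' = 1\<^sub>m n \<and> g' * g = 1\<^sub>m n)"

text \<open>
  For \<open>g\<close> in either of the two groups the diagonal of \<open>g x g\<^sup>-\<^sup>1\<close> is the image in \<open>S\<close> of the
  diagonal of \<open>x\<close>, because scalars are central. The corresponding element of \<open>T(S)\<close> therefore keeps
  the diagonal entries of \<open>x\<close> as elements of \<open>\<Phi>\<close>.
\<close>

definition conj_by ::
  "('k \<Rightarrow> 's \<Rightarrow> 's) \<Rightarrow> nat \<Rightarrow> 's :: {ring, monoid_mult} mat \<Rightarrow> ('k, 's) tri \<Rightarrow> ('k, 's) tri" where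
  "conj_by scale n g x = (fst x, strict_upper n (g * full_mat scale n x * mat_inverse n g))"

text \<open>
  Because diagonal entries live in \<open>\<Phi>\<close>, the classification below needs that no nonzero idempotent
  \<open>e\<close> of \<open>\<Phi>\<close> satisfies \<open>e R = 0\<close> (automatic if \<open>\<Phi>\<close> embeds in \<open>R\<close>). Otherwise \<open>e T(R)\<close> is the
  algebra of diagonal matrices over \<open>e \<Phi>\<close>, and any permutation of its \<open>n\<close> diagonal positions
  gives a Jordan automorphism of \<open>T(R)\<close>.
\<close>

end

theory Submission
  imports Defs
begin

text \<open>
  The images \<open>\<phi>(e\<^bsub>ii\<^esub>)\<close> are orthogonal idempotents with sum \<open>1\<close>, and their diagonals form an
  \<open>n \<times> n\<close> matrix \<open>p\<close> of idempotents of \<open>\<Phi>\<close> with orthogonal rows and columns, locally a permutation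
  matrix. A unitriangular conjugation makes every \<open>\<phi>(e\<^bsub>ii\<^esub>)\<close> equal to its diagonal. Afterwards \<open>\<phi>\<close>
  respects Peirce components for the Jordan product, and
  \<open>e\<^bsub>ij\<^esub>(a) \<circ> e\<^bsub>jk\<^esub>(b) = e\<^bsub>ik\<^esub>(ab)\<close> shows that \<open>p\<close> preserves betweenness of positions. Hence it is the
  identity on \<open>h \<Phi>\<close> and the reversal on \<open>(1 - h) \<Phi>\<close>, where \<open>h = p\<^bsub>00\<^esub>\<close>.
  The components of \<open>\<phi>\<close> are then bijections \<open>f\<^bsub>ij\<^esub>\<close> with \<open>f\<^bsub>ik\<^esub>(ab) = f\<^bsub>ij\<^esub>(a) f\<^bsub>jk\<^esub>(b)\<close> (with the
  opposite product on \<open>(1 - h) R\<close>). This forces the elements \<open>f\<^bsub>ij\<^esub>(1)\<close> to be invertible, and rescaling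
  by them, which is a diagonal conjugation, turns all \<open>f\<^bsub>ij\<^esub>\<close> into one multiplicative map.
\<close>

subsection \<open>Algebras and triangular matrices\<close>

context unital_algebra
begin

lemma scale_zero_right [simp]: "scale c 0 = 0"
  using scale_add_right[of c 0 0] by simp

lemma scale_zero_left [simp]: "scale 0 x = 0"
  using scale_add_left[of 0 0 x] by simp

lemma scale_sum_right: "scale c (sum f A) = (\<Sum>i\<in>A. scale c (f i))"
  by (induction A rule: infinite_finite_induct) (auto simp: scale_add_right)

lemma scale_sum_left: "scale (sum f A) x = (\<Sum>i\<in>A. scale (f i) x)"
  by (induction A rule: infinite_finite_induct) (auto simp: scale_add_left)

lemma scale_diff_left: "scale (c - d) x = scale c x - scale d x"
  using scale_add_left[of "c - d" d x] by (simp add: algebra_simps)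

lemma scale_diff_right: "scale c (x - y) = scale c x - scale c y"
  using scale_add_right[of c "x - y" y] by (simp add: algebra_simps)

lemma scale_mult_scale: "scale c x * scale d y = scale (c * d) (x * y)"
  by (simp add: scale_mult_left scale_mult_right scale_scale mult.commute)

lemma scale_split: "scale h x + scale (1 - h) x = x"
  by (simp add: scale_diff_left scale_one)

end

lemma (in unital_algebra) scale_range_mult:
  assumes "c * d = 0" "x \<in> range (scale c)" "y \<in> range (scale d)"
  shows "x * y = 0" "y * x = 0"
  using assms by (auto simp: scale_mult_scale mult.commute[of d c])

lemma (in unital_algebra) scale_range_unit:
  assumes "c * c = c"
  shows "scale c 1 \<in> range (scale c)"
    and "x \<in> range (scale c) \<Longrightarrow> scale c 1 * x = x"
    and "x \<in> range (scale c) \<Longrightarrow> x * scale c 1 = x"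
    and "x \<in> range (scale c) \<Longrightarrow> y \<in> range (scale c) \<Longrightarrow> x * y \<in> range (scale c)"
  using assms by (auto simp: scale_mult_scale)

text \<open>Coordinates for \<open>tri_carrier n\<close>: values of \<open>U\<close> on and below
  the diagonal are discarded, so elements are compared only at indices i < j, and every operation
  becomes a formula in \<open>d\<close> and \<open>U\<close>.\<close>

definition tri_of :: "nat \<Rightarrow> (nat \<Rightarrow> 'k) \<Rightarrow> (nat \<Rightarrow> nat \<Rightarrow> 'a :: zero) \<Rightarrow> ('k, 'a) tri" where
  "tri_of n d U = (vec n d, mat n n (\<lambda>(i, j). if i < j then U i j else 0))"

lemma tri_of_carrier [simp]: "tri_of n d U \<in> tri_carrier n"
  by (auto simp: tri_of_def tri_carrier_def)

lemma fst_tri_of [simp]: "i < n \<Longrightarrow> fst (tri_of n d U) $ i = d i"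
  by (simp add: tri_of_def)

lemma snd_tri_of [simp]:
  "i < n \<Longrightarrow> j < n \<Longrightarrow> snd (tri_of n d U) $$ (i, j) = (if i < j then U i j else 0)"
  by (simp add: tri_of_def)

lemma tri_of_eqI:
  assumes "\<And>i. i < n \<Longrightarrow> d i = d' i" and "\<And>i j. i < j \<Longrightarrow> j < n \<Longrightarrow> U i j = U' i j"
  shows "tri_of n d U = tri_of n d' U'"
  using assms by (auto simp: tri_of_def intro!: eq_vecI eq_matI)

lemma tri_of_collapse:
  assumes "x \<in> tri_carrier n"
  shows "tri_of n (\<lambda>i. fst x $ i) (\<lambda>i j. snd x $$ (i, j)) = x"
  using assms by (auto simp: tri_of_def tri_carrier_def intro!: prod_eqI eq_vecI eq_matI)

lemma tri_carrierE:
  assumes "x \<in> tri_carrier n"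
  obtains d U where "x = tri_of n d U"
  using tri_of_collapse[OF assms] by metis

lemma tri_eqI:
  assumes "x \<in> tri_carrier n" "y \<in> tri_carrier n"
    and "\<And>i. i < n \<Longrightarrow> fst x $ i = fst y $ i"
    and "\<And>i j. i < j \<Longrightarrow> j < n \<Longrightarrow> snd x $$ (i, j) = snd y $$ (i, j)"
  shows "x = y"
  using tri_of_eqI[of n "\<lambda>i. fst x $ i" "\<lambda>i. fst y $ i"
      "\<lambda>i j. snd x $$ (i, j)" "\<lambda>i j. snd y $$ (i, j)"] assms
  by (simp add: tri_of_collapse)

lemma tri_add_of:
  "tri_add (tri_of n d U) (tri_of n d' U') =
   tri_of n (\<lambda>i. d i + d' i) (\<lambda>i j. U i j + (U' i j :: 'a :: monoid_add))"
  by (auto simp: tri_of_def tri_add_def intro!: eq_vecI eq_matI)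

lemma (in unital_algebra) tri_scale_of:
  "tri_scale scale c (tri_of n d U) = tri_of n (\<lambda>i. c * d i) (\<lambda>i j. scale c (U i j))"
  by (auto simp: tri_of_def tri_scale_def intro!: eq_vecI eq_matI)

lemma (in unital_algebra) tri_mult_of:
  "tri_mult scale n (tri_of n d U) (tri_of n d' U') =
   tri_of n (\<lambda>i. d i * d' i)
     (\<lambda>i j. scale (d i) (U' i j) + scale (d' j) (U i j) + (\<Sum>k\<in>{i<..<j}. U i k * U' k j))"
proof -
  have "(full_mat scale n (tri_of n d U) * full_mat scale n (tri_of n d' U')) $$ (i, j) =
      scale (d i) (U' i j) + scale (d' j) (U i j) + (\<Sum>k\<in>{i<..<j}. U i k * U' k j)"
    if "i < j" "j < n" for i j
  proof -
    let ?f = "\<lambda>k. full_mat scale n (tri_of n d U) $$ (i, k) * full_mat scale n (tri_of n d' U') $$ (k, j)"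
    have "(full_mat scale n (tri_of n d U) * full_mat scale n (tri_of n d' U')) $$ (i, j) = sum ?f {..<n}"
      using that by (simp add: full_mat_def scalar_prod_def lessThan_atLeast0)
    also have "\<dots> = sum ?f {i..j}"
      by (rule sum.mono_neutral_right) (use that in \<open>auto simp: full_mat_index\<close>)
    also have "{i..j} = insert i (insert j {i<..<j})"
      using that by auto
    also have "sum ?f \<dots> = ?f i + (?f j + sum ?f {i<..<j})"
      using that by (subst sum.insert; simp)+
    also have "sum ?f {i<..<j} = (\<Sum>k\<in>{i<..<j}. U i k * U' k j)"
      by (rule sum.cong) (use that in \<open>auto simp: full_mat_index\<close>)
    also have "?f i = scale (d i) (U' i j)"
      using that by (simp add: full_mat_index scale_mult_left)
    also have "?f j = scale (d' j) (U i j)"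
      using that by (simp add: full_mat_index scale_mult_right)
    finally show ?thesis by (simp add: add.assoc)
  qed
  then show ?thesis
    by (auto simp: tri_mult_def strict_upper_def tri_of_def simp del: index_mult_mat intro!: eq_vecI eq_matI)
qed

lemma tri_add_carrier:
  "x \<in> tri_carrier n \<Longrightarrow> y \<in> tri_carrier n \<Longrightarrow> tri_add x (y :: (_, _ :: monoid_add) tri) \<in> tri_carrier n"
  by (auto simp: tri_add_of elim!: tri_carrierE)

context unital_algebra
begin

lemma tri_scale_carrier: "x \<in> tri_carrier n \<Longrightarrow> tri_scale scale c x \<in> tri_carrier n"
  by (auto simp: tri_scale_of elim!: tri_carrierE)

lemma tri_mult_carrier:
  "x \<in> tri_carrier n \<Longrightarrow> y \<in> tri_carrier n \<Longrightarrow> tri_mult scale n x y \<in> tri_carrier n"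
  by (auto simp: tri_mult_of elim!: tri_carrierE)

lemma full_mat_carrier [simp]: "full_mat scale n x \<in> carrier_mat n n"
  by (simp add: full_mat_def)

lemma full_mat_add:
  assumes "x \<in> tri_carrier n" "y \<in> tri_carrier n"
  shows "full_mat scale n (tri_add x y) = full_mat scale n x + full_mat scale n y"
proof -
  have "fst x \<in> carrier_vec n" "fst y \<in> carrier_vec n" "snd x \<in> carrier_mat n n" "snd y \<in> carrier_mat n n"
    using assms by (auto simp: tri_carrier_def)
  then show ?thesis
    by (auto simp: full_mat_def tri_add_def scale_add_left intro!: eq_matI)
qed

lemma full_mat_scale:
  assumes "x \<in> tri_carrier n"
  shows "full_mat scale n (tri_scale scale c x) = map_mat (scale c) (full_mat scale n x)"
proof -
  have "fst x \<in> carrier_vec n" "snd x \<in> carrier_mat n n"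
    using assms by (auto simp: tri_carrier_def)
  then show ?thesis
    by (auto simp: full_mat_def tri_scale_def scale_scale intro!: eq_matI)
qed

text \<open>The Jordan product without the factor 1/2, because 2 need not be invertible in
  \<Phi>.\<close>

definition tri_circ :: "nat \<Rightarrow> ('k, 'a) tri \<Rightarrow> ('k, 'a) tri \<Rightarrow> ('k, 'a) tri" where
  "tri_circ n x y = tri_add (tri_mult scale n x y) (tri_mult scale n y x)"

lemma tri_square_add:
  assumes "x \<in> tri_carrier n" "y \<in> tri_carrier n"
  shows "tri_mult scale n (tri_add x y) (tri_add x y) =
    tri_add (tri_add (tri_mult scale n x x) (tri_mult scale n y y)) (tri_circ n x y)"
proof -
  obtain d U d' U' where "x = tri_of n d U" "y = tri_of n d' U'"
    using assms by (metis tri_carrierE)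
  then show ?thesis
    by (simp only: tri_add_of tri_mult_of tri_circ_def)
      (rule tri_of_eqI; simp add: algebra_simps scale_add_left scale_add_right sum.distrib)
qed

lemma tri_circ_carrier:
  "x \<in> tri_carrier n \<Longrightarrow> y \<in> tri_carrier n \<Longrightarrow> tri_circ n x y \<in> tri_carrier n"
  by (simp add: tri_circ_def tri_add_carrier tri_mult_carrier)

end

lemma (in unital_algebra) fst_tri_index:
  assumes "x \<in> tri_carrier n" "i < n"
  shows "y \<in> tri_carrier n \<Longrightarrow> fst (tri_add x y) $ i = fst x $ i + fst y $ i"
    and "fst (tri_scale scale c x) $ i = c * fst x $ i"
    and "y \<in> tri_carrier n \<Longrightarrow> fst (tri_mult scale n x y) $ i = fst x $ i * fst y $ i"
    and "y \<in> tri_carrier n \<Longrightarrow> fst (tri_circ n x y) $ i = fst x $ i * fst y $ i + fst y $ i * fst x $ i"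
  using assms by (auto simp: tri_add_of tri_scale_of tri_mult_of tri_circ_def elim!: tri_carrierE)

lemma tri_add_left_cancel:
  fixes x y z :: "('k :: group_add, 'a :: group_add) tri"
  assumes "x \<in> tri_carrier n" "y \<in> tri_carrier n" "z \<in> tri_carrier n" "tri_add x y = tri_add x z"
  shows "y = z"
proof (rule tri_eqI[OF assms(2,3)])
  have c: "fst x \<in> carrier_vec n" "fst y \<in> carrier_vec n" "fst z \<in> carrier_vec n"
    "snd x \<in> carrier_mat n n" "snd y \<in> carrier_mat n n" "snd z \<in> carrier_mat n n"
    using assms by (auto simp: tri_carrier_def)
  show "fst y $ i = fst z $ i" if "i < n" for i
    using arg_cong[OF assms(4), of "\<lambda>v. fst v $ i"] that c by (simp add: tri_add_def)
  show "snd y $$ (i, j) = snd z $$ (i, j)" if "i < j" "j < n" for i j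
    using arg_cong[OF assms(4), of "\<lambda>v. snd v $$ (i, j)"] that c by (simp add: tri_add_def)
qed

section \<open>Matrix units and additive maps\<close>

definition dunit :: "nat \<Rightarrow> nat \<Rightarrow> ('k :: {zero, one}, 'a :: zero) tri" where
  "dunit n i = tri_of n (\<lambda>k. if k = i then 1 else 0) (\<lambda>_ _. 0)"

text \<open>This is e_ij(a) when i < j; for i \<ge> j the encoding by \<open>tri_of\<close> turns it
  into zero.\<close>

definition nunit :: "nat \<Rightarrow> nat \<Rightarrow> nat \<Rightarrow> 'a \<Rightarrow> ('k :: zero, 'a :: zero) tri" where
  "nunit n i j a = tri_of n (\<lambda>_. 0) (\<lambda>s t. if s = i \<and> t = j then a else 0)"

definition tri_zero :: "nat \<Rightarrow> ('k :: zero, 'a :: zero) tri" where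
  "tri_zero n = tri_of n (\<lambda>_. 0) (\<lambda>_ _. 0)"

lemma unit_carrier [simp]:
  "dunit n i \<in> tri_carrier n" "nunit n i j a \<in> tri_carrier n" "tri_zero n \<in> tri_carrier n"
  by (simp_all add: dunit_def nunit_def tri_zero_def)

context unital_algebra
begin

lemma dunit_square: "tri_mult scale n (dunit n i) (dunit n i) = dunit n i"
  by (auto simp: dunit_def tri_mult_of intro!: tri_of_eqI)

lemma dunit_orth: "i \<noteq> j \<Longrightarrow> tri_mult scale n (dunit n i) (dunit n j) = tri_zero n"
  by (auto simp: dunit_def tri_zero_def tri_mult_of intro!: tri_of_eqI)

lemma tri_zero_mult: "x \<in> tri_carrier n \<Longrightarrow> tri_mult scale n (tri_zero n) x = tri_zero n"
  using tri_mult_of[of n "\<lambda>_. 0" "\<lambda>_ _. 0" "\<lambda>i. fst x $ i" "\<lambda>i j. snd x $$ (i, j)"]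
  by (simp add: tri_of_collapse tri_zero_def)

lemma tri_circ_dunit_nunit:
  assumes "i < j" "k = i \<or> k = j"
  shows "tri_circ n (dunit n k) (nunit n i j a) = nunit n i j a"
  using assms
  by (auto simp: dunit_def nunit_def tri_circ_def tri_add_of tri_mult_of scale_one intro!: tri_of_eqI)

lemma tri_sandwich_dunit_nunit:
  assumes "i < j"
  shows "tri_mult scale n (tri_mult scale n (dunit n k) (nunit n i j a)) (dunit n k) = tri_zero n"
  using assms
  by (auto simp: dunit_def nunit_def tri_mult_of tri_zero_def scale_one intro!: tri_of_eqI)

text \<open>The product in the other order vanishes because k \<noteq> i, so the Jordan product
  recovers the associative product a b. This is what later makes the components of \<phi>
  multiplicative.\<close>

lemma tri_circ_nunit:
  assumes "i < j" "j < k"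
  shows "tri_circ n (nunit n i j a) (nunit n j k b) = nunit n i k (a * b)"
proof -
  have "(\<Sum>m\<in>{s<..<t}. (if s = i \<and> m = j then a else 0) * (if m = j \<and> t = k then b else 0)) +
      (\<Sum>m\<in>{s<..<t}. (if s = j \<and> m = k then b else 0) * (if m = i \<and> t = j then a else 0)) =
      (if s = i \<and> t = k then a * b else 0)" for s t
  proof -
    have "(if s = j \<and> m = k then b else 0) * (if m = i \<and> t = j then a else 0) = 0" for m
      using assms by auto
    moreover have "(if s = i \<and> m = j then a else 0) * (if m = j \<and> t = k then b else 0) =
        (if m = j then (if s = i \<and> t = k then a * b else 0) else 0)" for m
      by auto
    ultimately show ?thesis using assms by (simp add: sum.delta)
  qed
  then show ?thesis
    by (auto simp: nunit_def tri_circ_def tri_add_of tri_mult_of intro!: tri_of_eqI)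
qed

lemma tri_scale_nunit: "tri_scale scale c (nunit n i j a) = nunit n i j (scale c a)"
  by (auto simp: nunit_def tri_scale_of intro!: tri_of_eqI)

end

lemma nunit_add: "nunit n i j (a + b) = tri_add (nunit n i j a) (nunit n i j b :: ('k :: monoid_add, 'a :: monoid_add) tri)"
  by (auto simp: nunit_def tri_add_of intro!: tri_of_eqI)

lemma nunit_eq_zero:
  assumes "i < j" "j < n" "nunit n i j a = (tri_zero n :: ('k :: zero, 'a :: zero) tri)"
  shows "a = 0"
  using arg_cong[OF assms(3), of "\<lambda>x. snd x $$ (i, j)"] assms(1,2)
  by (simp add: nunit_def tri_zero_def)

lemma additive_tri_sum:
  fixes L :: "('k :: comm_monoid_add, 'a :: comm_monoid_add) tri \<Rightarrow> 'b :: ab_group_add"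
  assumes L: "\<And>x y. x \<in> tri_carrier n \<Longrightarrow> y \<in> tri_carrier n \<Longrightarrow> L (tri_add x y) = L x + L y"
    and "finite A"
  shows "L (tri_of n (\<lambda>i. \<Sum>k\<in>A. D k i) (\<lambda>i j. \<Sum>k\<in>A. V k i j)) = (\<Sum>k\<in>A. L (tri_of n (D k) (V k)))"
  using assms(2)
proof (induction A)
  case empty
  have "L (tri_zero n) = L (tri_zero n) + L (tri_zero n)"
    using L[of "tri_zero n" "tri_zero n"] by (simp add: tri_zero_def tri_add_of)
  then show ?case by (simp add: tri_zero_def)
next
  case (insert q A)
  then show ?case
    using L[of "tri_of n (D q) (V q)" "tri_of n (\<lambda>i. \<Sum>k\<in>A. D k i) (\<lambda>i j. \<Sum>k\<in>A. V k i j)"]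
    by (simp add: tri_add_of)
qed

text \<open>An additive map into a group is determined by its values on multiples of the e_kk and on
  the e_ij(a). Later \<open>L\<close> is an entry of the diagonal of \<open>\<phi> x\<close> or of
  the matrix \<open>K x\<close>.\<close>

lemma additive_tri_decomp:
  fixes L :: "('k :: {comm_ring, monoid_mult}, 'a :: {ring, monoid_mult}) tri \<Rightarrow> 'b :: ab_group_add"
  assumes alg: "unital_algebra sc"
    and L: "\<And>x y. x \<in> tri_carrier n \<Longrightarrow> y \<in> tri_carrier n \<Longrightarrow> L (tri_add x y) = L x + L y"
    and x: "x \<in> tri_carrier n"
  shows "L x = (\<Sum>k<n. L (tri_scale sc (fst x $ k) (dunit n k))) +
    (\<Sum>(i, j) | i < j \<and> j < n. L (nunit n i j (snd x $$ (i, j))))"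
proof -
  interpret unital_algebra sc by fact
  define P where "P = {(i, j). i < j \<and> j < n}"
  have "P \<subseteq> {..<n} \<times> {..<n}" by (auto simp: P_def)
  then have fin: "finite P" by (rule finite_subset) auto
  \<comment> \<open>The diagonal part, with its zeros written as \<open>sc (fst x $ k) 0\<close> so
    that each summand has the form that \<open>tri_scale_of\<close> gives for a multiple of
    \<open>dunit n k\<close>; \<open>Y\<close> is the strictly upper part.\<close>
  define X where "X = tri_of n (\<lambda>i. \<Sum>k<n. fst x $ k * (if i = k then 1 else 0)) (\<lambda>i j. \<Sum>k<n. sc (fst x $ k) (0 :: 'a))"
  define Y where "Y = tri_of n (\<lambda>i. \<Sum>q\<in>P. (0 :: 'k)) (\<lambda>i j. \<Sum>q\<in>P. if i = fst q \<and> j = snd q then snd x $$ (fst q, snd q) else 0)"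
  have "x = tri_add X Y"
  proof -
    have 1: "(\<Sum>k<n. fst x $ k * (if i = k then 1 else 0)) = fst x $ i" if "i < n" for i
      using that by (simp add: if_distrib[of "\<lambda>v. _ * v"] sum.delta cong: if_cong)
    have "(\<Sum>q\<in>P. if i = fst q \<and> j = snd q then snd x $$ (fst q, snd q) else 0) =
        (\<Sum>q\<in>P. if q = (i, j) then snd x $$ (i, j) else 0)" for i j
      by (intro sum.cong) (auto simp: prod_eq_iff)
    then have 2: "(\<Sum>q\<in>P. if i = fst q \<and> j = snd q then snd x $$ (fst q, snd q) else 0) = snd x $$ (i, j)"
      if "i < j" "j < n" for i j
      using that fin by (simp add: sum.delta P_def)
    have "tri_add X Y = tri_of n (\<lambda>i. fst x $ i) (\<lambda>i j. snd x $$ (i, j))"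
      unfolding X_def Y_def tri_add_of by (rule tri_of_eqI) (simp_all add: 1 2)
    then show ?thesis using x by (simp add: tri_of_collapse)
  qed
  moreover have "X \<in> tri_carrier n" "Y \<in> tri_carrier n" by (simp_all add: X_def Y_def)
  ultimately have "L x = L X + L Y" using L by simp
  also have "L X = (\<Sum>k<n. L (tri_of n (\<lambda>i. fst x $ k * (if i = k then 1 else 0)) (\<lambda>i j. sc (fst x $ k) 0)))"
    unfolding X_def by (rule additive_tri_sum[of n L, OF L]) auto
  also have "\<dots> = (\<Sum>k<n. L (tri_scale sc (fst x $ k) (dunit n k)))"
    by (simp add: dunit_def tri_scale_of)
  also have "L Y = (\<Sum>q\<in>P. L (tri_of n (\<lambda>i. 0) (\<lambda>i j. if i = fst q \<and> j = snd q then snd x $$ (fst q, snd q) else 0)))"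
    unfolding Y_def by (rule additive_tri_sum[of n L, OF L fin])
  also have "\<dots> = (\<Sum>(i, j)\<in>P. L (nunit n i j (snd x $$ (i, j))))"
    by (simp add: nunit_def case_prod_unfold)
  finally show ?thesis by (simp add: P_def)
qed

subsection \<open>Matrices\<close>

lemma mult_mat_index:
  assumes "A \<in> carrier_mat n n" "B \<in> carrier_mat n n" "i < n" "j < n"
  shows "(A * B) $$ (i, j) = (\<Sum>k<n. A $$ (i, k) * B $$ (k, j))"
  using assms by (auto simp: scalar_prod_def lessThan_atLeast0)

lemma one_mat_mult:
  fixes A :: "'a :: {ring, monoid_mult} mat"
  assumes "A \<in> carrier_mat n n"
  shows "1\<^sub>m n * A = A" "A * 1\<^sub>m n = A"
proof -
  have "(\<Sum>k<n. (1\<^sub>m n :: 'a mat) $$ (i, k) * A $$ (k, j)) = A $$ (i, j)"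
    "(\<Sum>k<n. A $$ (i, k) * 1\<^sub>m n $$ (k, j)) = A $$ (i, j)" if "i < n" "j < n" for i j
  proof -
    have "(\<Sum>k<n. (1\<^sub>m n :: 'a mat) $$ (i, k) * A $$ (k, j)) = (\<Sum>k<n. if k = i then A $$ (i, j) else 0)"
      "(\<Sum>k<n. A $$ (i, k) * 1\<^sub>m n $$ (k, j)) = (\<Sum>k<n. if k = j then A $$ (i, j) else 0)"
      by (rule sum.cong; use that in auto)+
    then show "(\<Sum>k<n. (1\<^sub>m n :: 'a mat) $$ (i, k) * A $$ (k, j)) = A $$ (i, j)"
      "(\<Sum>k<n. A $$ (i, k) * 1\<^sub>m n $$ (k, j)) = A $$ (i, j)"
      using that by (simp_all only: sum.delta finite_lessThan lessThan_iff if_True)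
  qed
  then show "1\<^sub>m n * A = A" "A * 1\<^sub>m n = A"
    using assms
    by (auto simp: mult_mat_index[of _ n] simp del: index_mult_mat(1) index_one_mat(1) intro!: eq_matI)
qed

lemma mat_inverse_eqI:
  fixes g :: "'a :: {ring, monoid_mult} mat"
  assumes "g \<in> carrier_mat n n" "g' \<in> carrier_mat n n" "g * g' = 1\<^sub>m n" "g' * g = 1\<^sub>m n"
  shows "mat_inverse n g = g'"
  unfolding mat_inverse_def
proof (rule the_equality)
  fix k assume k: "k \<in> carrier_mat n n \<and> g * k = 1\<^sub>m n \<and> k * g = 1\<^sub>m n"
  then have "k = (g' * g) * k" using assms by (simp add: one_mat_mult)
  also have "\<dots> = g' * (g * k)" using assms k by (intro assoc_mult_mat) auto
  finally show "k = g'" using assms k by (simp add: one_mat_mult)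
qed (use assms in auto)

text \<open>Multiplying A B + B A = 0 on the left by A gives A B + A B A = 0, and A B A is
  zero.\<close>

lemma orthogonal_idempotents_mat:
  fixes A B :: "'a :: ring mat"
  assumes A: "A \<in> carrier_mat n n" and B: "B \<in> carrier_mat n n"
    and "A * A = A" "A * B + B * A = 0\<^sub>m n n" "A * B * A = 0\<^sub>m n n"
  shows "A * B = 0\<^sub>m n n"
proof -
  have "A * (A * B + B * A) = A * (A * B) + A * (B * A)"
    using A B by (intro mult_add_distrib_mat) auto
  also have "A * (A * B) = A * A * B" using A B by (intro assoc_mult_mat[symmetric]) auto
  also have "A * (B * A) = A * B * A" using A B by (intro assoc_mult_mat[symmetric]) auto
  finally show ?thesis using A B assms(3-5) by simp
qed

lemma upper_triangular_mult:
  fixes A B :: "'a :: ring mat"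
  assumes "A \<in> carrier_mat n n" "B \<in> carrier_mat n n" "upper_triangular A" "upper_triangular B"
  shows "upper_triangular (A * B)"
proof (rule upper_triangularI)
  fix i j assume ij: "j < i" "i < dim_row (A * B)"
  then have i: "i < n" using assms by simp
  have "A $$ (i, k) * B $$ (k, j) = 0" if "k < n" for k
    using upper_triangularD[OF assms(3), of k i] upper_triangularD[OF assms(4), of j k] ij i that assms(1,2)
    by (cases "k < i") auto
  then show "(A * B) $$ (i, j) = 0"
    using ij i assms by (simp add: mult_mat_index del: index_mult_mat(1))
qed

text \<open>Column j of X g is column j of X plus right multiples of earlier columns, so the columns
  of X vanish one after another. This later turns a left inverse of g into a two-sided one.\<close>

lemma unitriangular_right_cancel:
  fixes X :: "'a :: {ring, monoid_mult} mat"
  assumes X: "X \<in> carrier_mat n n" and g: "g \<in> UT n" and "X * g = 0\<^sub>m n n"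
  shows "X = 0\<^sub>m n n"
proof -
  have gc: "g \<in> carrier_mat n n" "upper_triangular g" and g1: "\<And>i. i < n \<Longrightarrow> g $$ (i, i) = 1"
    using g by (auto simp: UT_def)
  have "X $$ (i, j) = 0" if "i < n" "j < n" for i j
    using that(2)
  proof (induction j rule: less_induct)
    case (less j)
    have "0 = (X * g) $$ (i, j)" using assms(3) that less by simp
    also have "\<dots> = (\<Sum>k<n. X $$ (i, k) * g $$ (k, j))"
      using X gc that less by (simp add: mult_mat_index del: index_mult_mat(1))
    also have "\<dots> = (\<Sum>k<n. if k = j then X $$ (i, j) else 0)"
    proof (rule sum.cong)
      fix k assume k: "k \<in> {..<n}"
      consider "k < j" | "k = j" | "j < k" by linarith
      then show "X $$ (i, k) * g $$ (k, j) = (if k = j then X $$ (i, j) else 0)"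
        by cases (use less k g1 gc upper_triangularD[OF gc(2), of j k] in auto)
    qed simp
    finally show ?case using less by (simp add: sum.delta)
  qed
  then show ?thesis using X by (auto intro!: eq_matI)
qed

text \<open>\<open>full_mat\<close> sees a diagonal entry only through its image in S, which may
  lose information; equality of the \<Phi>-diagonals is therefore a separate premise.\<close>

lemma conj_by_eqI:
  fixes sc :: "'k \<Rightarrow> 's :: {ring, monoid_mult} \<Rightarrow> 's"
  assumes "w \<in> tri_carrier n" "z \<in> tri_carrier n"
    and g: "g \<in> carrier_mat n n" "g' \<in> carrier_mat n n" "g * g' = 1\<^sub>m n" "g' * g = 1\<^sub>m n"
    and "\<And>i. i < n \<Longrightarrow> fst w $ i = fst z $ i"
    and "full_mat sc n w = g * full_mat sc n z * g'"
  shows "w = conj_by sc n g z"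
proof -
  have c: "fst w \<in> carrier_vec n" "fst z \<in> carrier_vec n" "snd w \<in> carrier_mat n n"
    using assms by (auto simp: tri_carrier_def)
  have "strict_upper n (full_mat sc n w) = snd w"
    using assms(1) c by (auto simp: strict_upper_def full_mat_def tri_carrier_def intro!: eq_matI)
  moreover have "fst w = fst z" using c assms(7) by (intro eq_vecI) auto
  ultimately show ?thesis
    unfolding conj_by_def mat_inverse_eqI[OF g] assms(8)[symmetric] by (simp add: prod_eq_iff)
qed

subsection \<open>Families of idempotents that preserve betweenness\<close>

text \<open>After multiplication by h, the rows of p behave like a strictly increasing self-map of
  {0, ..., n - 1}, hence like the identity. Instead of localising, the argument inserts the
  partitions of unity given by the rows.\<close>

lemma monotone_idempotents:
  fixes p :: "nat \<Rightarrow> nat \<Rightarrow> 'k :: {comm_ring, monoid_mult}"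
  assumes rs: "\<And>i. i < n \<Longrightarrow> (\<Sum>a<n. p i a) = 1"
    and mono: "\<And>i j a b. i < j \<Longrightarrow> j < n \<Longrightarrow> a < n \<Longrightarrow> b < n \<Longrightarrow> \<not> a < b \<Longrightarrow> h * p i a * p j b = 0"
    and "i < n" "a < n"
  shows "h * p i a = (if a = i then h else 0)"
proof -
  have expand: "h * p i a = (\<Sum>b<n. h * p i a * p j b)" if "j < n" for i j a
    using rs[OF that] by (simp add: sum_distrib_left[symmetric])
  \<comment> \<open>Upward induction: if row i + 1 hit some a < i + 1, row i would have to hit some
    b < a, so b < i.\<close>
  have low: "h * p i a = 0" if "a < i" "i < n" for i a
    using that
  proof (induction i arbitrary: a)
    case (Suc i)
    have "h * p (Suc i) a * p i b = 0" if "b < n" for b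
    proof (cases "b < a")
      case True
      then have "h * p i b = 0" using Suc by auto
      then have "p (Suc i) a * (h * p i b) = 0" by simp
      then show ?thesis by (simp only: ac_simps)
    next
      case False
      then have "h * p i b * p (Suc i) a = 0" using mono[of i "Suc i" b a] Suc that by auto
      then show ?thesis by (simp add: ac_simps)
    qed
    then show ?case using expand[of i "Suc i" a] Suc by simp
  qed simp
  \<comment> \<open>Downward induction from i = n - 1, where no a > i is left: if row i hit a > i,
    row i + 1 would hit some b > a, so b > i + 1.\<close>
  have high: "h * p i a = 0" if "i < a" "a < n" for i a
  proof -
    have "\<forall>a. i < a \<longrightarrow> a < n \<longrightarrow> h * p i a = 0" if "i \<le> n - 1" for i
      using that
    proof (induction i rule: inc_induct)
      case (step i)
      show ?case
      proof (intro allI impI)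
        fix a assume a: "i < a" "a < n"
        have "h * p i a * p (Suc i) b = 0" if "b < n" for b
        proof (cases "a < b")
          case True
          then have "h * p (Suc i) b = 0" using step a that by auto
          then have "p i a * (h * p (Suc i) b) = 0" by simp
          then show ?thesis by (simp only: ac_simps)
        next
          case False
          then show ?thesis using mono[of i "Suc i" a b] a that by auto
        qed
        then show "h * p i a = 0" using expand[of "Suc i" i a] a by simp
      qed
    qed auto
    then show ?thesis using that by simp
  qed
  have "h = (\<Sum>b<n. h * p i b)" using rs[OF \<open>i < n\<close>] by (simp add: sum_distrib_left[symmetric])
  also have "\<dots> = (\<Sum>b<n. if b = i then h * p i i else 0)"
    using low[of _ i] high[of i] \<open>i < n\<close> by (intro sum.cong) (auto simp: neq_iff)
  finally have "h = h * p i i" using \<open>i < n\<close> by (simp add: sum.delta)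
  then show ?thesis using low[of a i] high[of i a] assms(3,4) by (cases a i rule: linorder_cases) auto
qed

text \<open>Locally p is a permutation preserving betweenness. The end position 0 must go to an end,
  so \<open>p 0 0\<close> and \<open>p 0 (n - 1)\<close> are complementary; betweenness relative to
  0 then makes the permutation increasing on the first part and decreasing on the second.\<close>

lemma betweenness_idempotents:
  fixes p :: "nat \<Rightarrow> nat \<Rightarrow> 'k :: {comm_ring, monoid_mult}"
  assumes n: "n \<ge> 3"
    and idem: "\<And>i a. i < n \<Longrightarrow> a < n \<Longrightarrow> p i a * p i a = p i a"
    and rs: "\<And>i. i < n \<Longrightarrow> (\<Sum>a<n. p i a) = 1"
    and cs: "\<And>a. a < n \<Longrightarrow> (\<Sum>i<n. p i a) = 1"
    and ro: "\<And>i a b. i < n \<Longrightarrow> a < n \<Longrightarrow> b < n \<Longrightarrow> a \<noteq> b \<Longrightarrow> p i a * p i b = 0"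
    and co: "\<And>i j a. i < n \<Longrightarrow> j < n \<Longrightarrow> a < n \<Longrightarrow> i \<noteq> j \<Longrightarrow> p i a * p j a = 0"
    and betw: "\<And>i j k a b c. i < j \<Longrightarrow> j < k \<Longrightarrow> k < n \<Longrightarrow> a < n \<Longrightarrow> b < n \<Longrightarrow> c < n \<Longrightarrow>
      \<not> (a < b \<and> b < c) \<Longrightarrow> \<not> (c < b \<and> b < a) \<Longrightarrow> p i a * p j b * p k c = 0"
  obtains h where "h * h = h"
    and "\<And>i a. i < n \<Longrightarrow> a < n \<Longrightarrow> h * p i a = (if a = i then h else 0)"
    and "\<And>i a. i < n \<Longrightarrow> a < n \<Longrightarrow> (1 - h) * p i a = (if a = n - 1 - i then 1 - h else 0)"
proof -
  define h where "h = p 0 0"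
  have mid: "p 0 a = 0" if a: "0 < a" "a < n - 1" for a
  proof -
    \<comment> \<open>If 0 went to an interior a, let j go to 0 and k to n - 1. The middle one of
      the positions 0, j, k is j or k, and its image is an end, not between the other two images.
      Coincidences among 0, j, k fall to row orthogonality.\<close>
    have z: "p 0 a * p j 0 * p k (n - 1) = 0" if jk: "j < n" "k < n" for j k
    proof -
      consider "j = 0" | "k = 0" | "j = k" | "0 < j" "j < k" | "0 < k" "k < j" by linarith
      then show ?thesis
      proof cases
        case 1
        then show ?thesis using ro[of 0 a 0] a by simp
      next
        case 2
        have "p 0 a * p j 0 * p 0 (n - 1) = p j 0 * (p 0 a * p 0 (n - 1))"
          by (simp only: ac_simps)
        then show ?thesis using 2 ro[of 0 a "n - 1"] a by simp
      next
        case 3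
        then show ?thesis using ro[of j 0 "n - 1"] jk a by (simp add: mult.assoc)
      next
        case 4
        then show ?thesis using betw[of 0 j k a 0 "n - 1"] jk a by simp
      next
        case 5
        then have "p 0 a * p k (n - 1) * p j 0 = 0" using betw[of 0 k j a "n - 1" 0] jk a by simp
        then show ?thesis by (simp add: ac_simps)
      qed
    qed
    have "p 0 a = p 0 a * (\<Sum>j<n. p j 0) * (\<Sum>k<n. p k (n - 1))"
      using cs[of 0] cs[of "n - 1"] n by simp
    also have "\<dots> = (\<Sum>j<n. \<Sum>k<n. p 0 a * p j 0 * p k (n - 1))"
      by (simp add: sum_distrib_left sum_distrib_right) (rule sum.swap)
    finally show ?thesis using z by simp
  qed
  have "1 = (\<Sum>a<n. p 0 a)" using rs[of 0] n by simp
  also have "\<dots> = (\<Sum>a\<in>{0, n - 1}. p 0 a)"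
  proof (rule sum.mono_neutral_right)
    show "\<forall>a\<in>{..<n} - {0, n - 1}. p 0 a = 0"
    proof
      fix a assume "a \<in> {..<n} - {0, n - 1}"
      then have "0 < a" "a < n - 1" by auto
      then show "p 0 a = 0" by (rule mid)
    qed
  qed (use n in auto)
  also have "\<dots> = h + p 0 (n - 1)" using n by (simp add: h_def)
  finally have h': "1 - h = p 0 (n - 1)" by (simp add: algebra_simps)
  have hh: "h * h = h" using idem n by (simp add: h_def)
  \<comment> \<open>The factor h sends 0 to 0, so betweenness for 0 < i < j forces a < b. For i = 0,
    row orthogonality forces a = 0, and then b = 0 collides with it in column 0.\<close>
  have up: "h * p i a * p j b = 0" if "i < j" "j < n" "a < n" "b < n" "\<not> a < b" for i j a b
  proof (cases "i = 0")
    case True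
    show ?thesis
    proof (cases "a = 0")
      case True
      then show ?thesis using \<open>i = 0\<close> that co[of 0 j 0] hh by (simp add: h_def)
    next
      case False
      then show ?thesis using \<open>i = 0\<close> that ro[of 0 0 a] n by (simp add: h_def)
    qed
  next
    case False
    then show ?thesis using betw[of 0 i j 0 a b] that by (simp add: h_def)
  qed
  have down: "(1 - h) * p i a * p j b = 0" if "i < j" "j < n" "a < n" "b < n" "\<not> b < a" for i j a b
  proof (cases "i = 0")
    case True
    show ?thesis
    proof (cases "a = n - 1")
      case True
      then have "b = n - 1" using that by linarith
      then show ?thesis using \<open>i = 0\<close> True that co[of 0 j "n - 1"] n idem[of 0 "n - 1"] by (simp add: h')
    next
      case False
      then show ?thesis using \<open>i = 0\<close> that ro[of 0 "n - 1" a] n by (simp add: h')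
    qed
  next
    case False
    have "p 0 (n - 1) * p i a * p j b = 0" by (rule betw) (use that False in auto)
    then show ?thesis by (simp add: h')
  qed
  have rev: "(\<Sum>a<n. p i (n - 1 - a)) = 1" if "i < n" for i
    using sum.nat_diff_reindex[of "p i" n] rs[OF that] by simp
  have "h * p i a = (if a = i then h else 0)" if "i < n" "a < n" for i a
    by (rule monotone_idempotents[OF rs up]) (use that in auto)
  \<comment> \<open>Reversing the columns turns the decreasing case into the increasing one.\<close>
  moreover have anti: "(1 - h) * p i (n - 1 - a) = (if a = i then 1 - h else 0)" if "i < n" "a < n" for i a
    by (rule monotone_idempotents[of n "\<lambda>i a. p i (n - 1 - a)", OF rev down]) (use that in auto)
  have "(1 - h) * p i a = (if a = n - 1 - i then 1 - h else 0)" if "i < n" "a < n" for i a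
    using anti[of i "n - 1 - a"] that by auto
  ultimately show ?thesis using that hh by blast
qed

subsection \<open>Multiplicative chains of bijections\<close>

text \<open>
  The multiplication on the target is a parameter, so that the lemma also applies to the opposite
  multiplication, which is how the antimultiplicative summand is treated.
\<close>

lemma multiplicative_chain:
  fixes f :: "nat \<Rightarrow> nat \<Rightarrow> 'a :: times \<Rightarrow> 'b" and tm :: "'b \<Rightarrow> 'b \<Rightarrow> 'b" (infixl "\<diamondop>" 70)
  assumes n: "n \<ge> 3"
    and e: "e \<in> A" "\<And>a. a \<in> A \<Longrightarrow> e * a = a" "\<And>a. a \<in> A \<Longrightarrow> a * e = a"
    and A: "\<And>a b. a \<in> A \<Longrightarrow> b \<in> A \<Longrightarrow> a * b \<in> A"
    and w: "w \<in> H" "\<And>x. x \<in> H \<Longrightarrow> w \<diamondop> x = x" "\<And>x. x \<in> H \<Longrightarrow> x \<diamondop> w = x"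
    and H: "\<And>x y. x \<in> H \<Longrightarrow> y \<in> H \<Longrightarrow> x \<diamondop> y \<in> H"
    and assoc: "\<And>x y z. x \<diamondop> y \<diamondop> z = x \<diamondop> (y \<diamondop> z)"
    and bij: "\<And>i j. i < j \<Longrightarrow> j < n \<Longrightarrow> bij_betw (f i j) A H"
    and mul: "\<And>i j k a b. i < j \<Longrightarrow> j < k \<Longrightarrow> k < n \<Longrightarrow> a \<in> A \<Longrightarrow> b \<in> A \<Longrightarrow>
      f i k (a * b) = f i j a \<diamondop> f j k b"
  obtains d d' v where "\<And>i. i < n \<Longrightarrow> d i \<in> H \<and> d' i \<in> H \<and> d i \<diamondop> d' i = w \<and> d' i \<diamondop> d i = w"
    and "v \<in> H" and "bij_betw (\<lambda>a. f 0 1 a \<diamondop> v) A H"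
    and "\<And>a b. a \<in> A \<Longrightarrow> b \<in> A \<Longrightarrow> f 0 1 (a * b) \<diamondop> v = (f 0 1 a \<diamondop> v) \<diamondop> (f 0 1 b \<diamondop> v)"
    and "\<And>i j a. i < j \<Longrightarrow> j < n \<Longrightarrow> a \<in> A \<Longrightarrow> f i j a = d i \<diamondop> (f 0 1 a \<diamondop> v) \<diamondop> d' j"
proof -
  define u where "u = (\<lambda>i j. f i j e)"
  define inverses where "inverses x y \<longleftrightarrow> x \<in> H \<and> y \<in> H \<and> x \<diamondop> y = w \<and> y \<diamondop> x = w" for x y
  have fH: "f i j a \<in> H" if "i < j" "j < n" "a \<in> A" for i j a
    using bij_betwE[OF bij[OF that(1,2)]] that(3) by blast
  have uH: "u i j \<in> H" if "i < j" "j < n" for i j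
    using fH that e by (simp add: u_def)
  \<comment> \<open>Writing a as e a or as a e expresses one component through another and an
    element \<open>u i j\<close>, the image of the identity.\<close>
  have left: "f i k a = u i j \<diamondop> f j k a" if "i < j" "j < k" "k < n" "a \<in> A" for i j k a
    using mul[OF that(1-3) e(1) that(4)] e(2)[OF that(4)] by (simp add: u_def)
  have right: "f i k a = f i j a \<diamondop> u j k" if "i < j" "j < k" "k < n" "a \<in> A" for i j k a
    using mul[OF that(1-4) e(1)] e(3)[OF that(4)] by (simp add: u_def)
  \<comment> \<open>Left multiplication by \<open>u 0 j\<close> is \<open>f 0 (n - 1)\<close>
    composed with the inverse of \<open>f j (n - 1)\<close>, hence a bijection of H. A preimage of w
    is a right inverse of \<open>u 0 j\<close>, and injectivity makes it two-sided. The bound j < n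
    - 1 leaves room for the index n - 1.\<close>
  have inv_left: "\<exists>y. inverses (u 0 j) y" if "0 < j" "j < n - 1" for j
  proof -
    have "bij_betw ((\<lambda>y. u 0 j \<diamondop> y) \<circ> f j (n - 1)) A H \<longleftrightarrow> bij_betw (f 0 (n - 1)) A H"
      by (rule bij_betw_cong) (use left[of 0 j "n - 1"] that in auto)
    then have b: "bij_betw (\<lambda>y. u 0 j \<diamondop> y) H H"
      using bij_betw_comp_iff[OF bij[of j "n - 1"], of "\<lambda>y. u 0 j \<diamondop> y" H] bij[of 0 "n - 1"] that by simp
    then obtain y where y: "y \<in> H" "u 0 j \<diamondop> y = w"
      using w(1) bij_betw_imp_surj_on[OF b] by (metis (no_types, lifting) imageE)
    have "y \<diamondop> u 0 j = w"
    proof (rule inj_onD[OF bij_betw_imp_inj_on[OF b]])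
      show "u 0 j \<diamondop> (y \<diamondop> u 0 j) = u 0 j \<diamondop> w"
        using y w uH[of 0 j] that by (simp add: assoc[symmetric])
    qed (use y w H uH[of 0 j] that in auto)
    then show ?thesis using y uH[of 0 j] that by (auto simp: inverses_def)
  qed
  \<comment> \<open>For j = n - 1 there is no larger index, so \<open>u 0 (n - 1)\<close> will be
    factored through \<open>u 1 (n - 1)\<close>, which is treated from the right by comparing
    \<open>f 0 1\<close> with \<open>f 0 (n - 1)\<close>.\<close>
  have inv_right: "\<exists>y. inverses (u 1 (n - 1)) y"
  proof -
    have "bij_betw ((\<lambda>y. y \<diamondop> u 1 (n - 1)) \<circ> f 0 1) A H \<longleftrightarrow> bij_betw (f 0 (n - 1)) A H"
      by (rule bij_betw_cong) (use right[of 0 1 "n - 1"] n in auto)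
    then have b: "bij_betw (\<lambda>y. y \<diamondop> u 1 (n - 1)) H H"
      using bij_betw_comp_iff[OF bij[of 0 1], of "\<lambda>y. y \<diamondop> u 1 (n - 1)" H] bij[of 0 "n - 1"] n by simp
    then obtain y where y: "y \<in> H" "y \<diamondop> u 1 (n - 1) = w"
      using w(1) bij_betw_imp_surj_on[OF b] by (metis (no_types, lifting) imageE)
    have uu: "u 1 (n - 1) \<in> H" using uH n by simp
    have "u 1 (n - 1) \<diamondop> y = w"
    proof (rule inj_onD[OF bij_betw_imp_inj_on[OF b]])
      show "u 1 (n - 1) \<diamondop> y \<diamondop> u 1 (n - 1) = w \<diamondop> u 1 (n - 1)"
        using y w uu by (simp add: assoc)
    qed (use y w H uu in auto)
    then show ?thesis using y uu by (auto simp: inverses_def)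
  qed
  have inv_prod: "inverses (x \<diamondop> x2) (y2 \<diamondop> y)" if "inverses x y" "inverses x2 y2" for x y x2 y2
  proof -
    have "x \<diamondop> x2 \<diamondop> (y2 \<diamondop> y) = x \<diamondop> (x2 \<diamondop> y2 \<diamondop> y)" "y2 \<diamondop> y \<diamondop> (x \<diamondop> x2) = y2 \<diamondop> (y \<diamondop> x \<diamondop> x2)"
      by (simp_all only: assoc)
    then show ?thesis using that H w unfolding inverses_def by metis
  qed
  have "\<exists>y. inverses (u 0 j) y" if j: "0 < j" "j < n" for j
  proof (cases "j = n - 1")
    case True
    have "(0::nat) < 1" "1 < n - 1" "n - 1 < n" using n by simp_all
    note q = this
    have "u 0 (n - 1) = u 0 1 \<diamondop> u 1 (n - 1)"
      using left[OF q e(1)] unfolding u_def .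
    moreover obtain y where "inverses (u 0 1) y" using inv_left[OF q(1,2)] by (elim exE)
    moreover obtain y2 where "inverses (u 1 (n - 1)) y2" using inv_right by (elim exE)
    ultimately have "inverses (u 0 (n - 1)) (y2 \<diamondop> y)" using inv_prod by simp
    then show ?thesis unfolding True by (rule exI)
  qed (use j inv_left in auto)
  then obtain u' where u': "\<And>j. 0 < j \<Longrightarrow> j < n \<Longrightarrow> inverses (u 0 j) (u' j)" by metis
  \<comment> \<open>Index 0 serves as base point: \<open>d i\<close> is the inverse of
    \<open>u 0 i\<close>, with w in place of the missing \<open>u 0 0\<close>, and
    \<open>\<psi>\<close> is \<open>f 0 1\<close> stripped of \<open>u 0 1\<close>.\<close>
  define d where "d i = (if i = 0 then w else u' i)" for i
  define d' where "d' i = (if i = 0 then w else u 0 i)" for i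
  define \<psi> where "\<psi> a = f 0 1 a \<diamondop> u' 1" for a
  have u1: "inverses (u 0 1) (u' 1)" using u' n by simp
  have dd: "d i \<in> H \<and> d' i \<in> H \<and> d i \<diamondop> d' i = w \<and> d' i \<diamondop> d i = w" if "i < n" for i
    using u'[of i] that w by (auto simp: d_def d'_def inverses_def)
  have \<psi>H: "\<psi> a \<in> H" if "a \<in> A" for a
    using that H u1 fH[of 0 1 a] n by (simp add: \<psi>_def inverses_def)
  have f01: "f 0 1 a = \<psi> a \<diamondop> u 0 1" if "a \<in> A" for a
    using that u1 fH[of 0 1 a] n w by (simp add: \<psi>_def inverses_def assoc)
  have f0: "f 0 j a = \<psi> a \<diamondop> u 0 j" if "0 < j" "j < n" "a \<in> A" for j a
  proof (cases "j = 1")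
    case False
    then have "f 0 j a = f 0 1 a \<diamondop> u 1 j" "u 0 j = u 0 1 \<diamondop> u 1 j"
      using right[of 0 1 j a] left[of 0 1 j e] that e by (auto simp: u_def)
    then show ?thesis using f01[OF that(3)] by (simp add: assoc)
  qed (use f01 that in auto)
  have norm: "f i j a = d i \<diamondop> \<psi> a \<diamondop> d' j" if "i < j" "j < n" "a \<in> A" for i j a
  proof (cases "i = 0")
    case True
    then show ?thesis using f0[of j a] that w(2)[OF \<psi>H[OF that(3)]] by (simp add: d_def d'_def)
  next
    case False
    then have i: "inverses (u 0 i) (u' i)" using u' that by simp
    have "f i j a = u' i \<diamondop> (u 0 i \<diamondop> f i j a)"
      using i w(2)[OF fH[OF that]] by (simp add: assoc[symmetric] inverses_def)
    also have "u 0 i \<diamondop> f i j a = \<psi> a \<diamondop> u 0 j"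
      using left[of 0 i j a] f0[of j a] False that by simp
    finally show ?thesis using False that by (simp add: d_def d'_def assoc)
  qed
  have mult: "\<psi> (a * b) = \<psi> a \<diamondop> \<psi> b" if "a \<in> A" "b \<in> A" for a b
  proof -
    \<comment> \<open>Multiplicativity is read off from the triple 0 < 1 < 2, available since n
      \<ge> 3, by cancelling the invertible \<open>u 0 2\<close>.\<close>
    have u2: "inverses (u 0 2) (u' 2)" using u' n by simp
    have "\<psi> (a * b) \<diamondop> u 0 2 = f 0 2 (a * b)" using f0[of 2 "a * b"] A that n by simp
    also have "\<dots> = f 0 1 a \<diamondop> (u' 1 \<diamondop> \<psi> b \<diamondop> u 0 2)"
      using mul[of 0 1 2 a b] norm[of 1 2 b] that n by (simp add: d_def d'_def)
    also have "\<dots> = \<psi> a \<diamondop> \<psi> b \<diamondop> u 0 2" by (simp add: \<psi>_def assoc)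
    finally have "\<psi> (a * b) \<diamondop> u 0 2 \<diamondop> u' 2 = \<psi> a \<diamondop> \<psi> b \<diamondop> u 0 2 \<diamondop> u' 2" by simp
    then have "\<psi> (a * b) \<diamondop> w = \<psi> a \<diamondop> \<psi> b \<diamondop> w" using u2 by (simp add: inverses_def assoc)
    then show ?thesis using w(3) \<psi>H A H that by simp
  qed
  have "bij_betw ((\<lambda>x. x \<diamondop> u' 1) \<circ> f 0 1) A H"
  proof (rule bij_betw_trans[OF bij])
    show "bij_betw (\<lambda>x. x \<diamondop> u' 1) H H"
      by (rule bij_betwI[where g = "\<lambda>x. x \<diamondop> u 0 1"]) (use u1 H w in \<open>auto simp: inverses_def assoc\<close>)
  qed (use n in auto)
  then have "bij_betw \<psi> A H" by (simp add: \<psi>_def[abs_def] comp_def)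
  then show thesis
    using that[of d d' "u' 1"] dd u1 mult norm unfolding inverses_def \<psi>_def by blast
qed

subsection \<open>The diagonal of a Jordan isomorphism\<close>

locale tri_jordan_iso = R: unital_algebra scR + S: unital_algebra scS
  for scR :: "'k :: {comm_ring, monoid_mult} \<Rightarrow> 'r :: {ring, monoid_mult} \<Rightarrow> 'r"
    and scS :: "'k \<Rightarrow> 's :: {ring, monoid_mult} \<Rightarrow> 's" +
  fixes n :: nat and \<phi> :: "('k, 'r) tri \<Rightarrow> ('k, 's) tri"
  assumes n: "n \<ge> 3"
    and no_killing_idempotent: "\<And>e. e * e = e \<Longrightarrow> (\<forall>a. scR e a = 0) \<Longrightarrow> e = 0"
    and jordan: "jordan_iso scR scS n \<phi>"
begin

lemma phi_carrier: "x \<in> tri_carrier n \<Longrightarrow> \<phi> x \<in> tri_carrier n"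
  using jordan by (auto simp: jordan_iso_def jordan_hom_def)

lemma phi_add:
  "x \<in> tri_carrier n \<Longrightarrow> y \<in> tri_carrier n \<Longrightarrow> \<phi> (tri_add x y) = tri_add (\<phi> x) (\<phi> y)"
  using jordan by (auto simp: jordan_iso_def jordan_hom_def tri_linear_def)

lemma phi_scale: "x \<in> tri_carrier n \<Longrightarrow> \<phi> (tri_scale scR c x) = tri_scale scS c (\<phi> x)"
  using jordan by (auto simp: jordan_iso_def jordan_hom_def tri_linear_def)

lemma phi_square: "x \<in> tri_carrier n \<Longrightarrow> \<phi> (tri_mult scR n x x) = tri_mult scS n (\<phi> x) (\<phi> x)"
  using jordan by (auto simp: jordan_iso_def jordan_hom_def)

lemma phi_sandwich:
  "x \<in> tri_carrier n \<Longrightarrow> y \<in> tri_carrier n \<Longrightarrow>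
   \<phi> (tri_mult scR n (tri_mult scR n x y) x) = tri_mult scS n (tri_mult scS n (\<phi> x) (\<phi> y)) (\<phi> x)"
  using jordan by (auto simp: jordan_iso_def jordan_hom_def)

lemma phi_inj: "x \<in> tri_carrier n \<Longrightarrow> y \<in> tri_carrier n \<Longrightarrow> \<phi> x = \<phi> y \<Longrightarrow> x = y"
  using jordan by (auto simp: jordan_iso_def bij_betw_def dest: inj_onD)

lemma phi_surj:
  assumes "y \<in> tri_carrier n"
  obtains x where "x \<in> tri_carrier n" "\<phi> x = y"
proof -
  have "y \<in> \<phi> ` tri_carrier n" using jordan assms by (simp add: jordan_iso_def bij_betw_def)
  then show thesis using that by blast
qed

lemma phi_zero: "\<phi> (tri_zero n) = tri_zero n"
proof -
  have "tri_add (\<phi> (tri_zero n)) (\<phi> (tri_zero n)) = \<phi> (tri_add (tri_zero n) (tri_zero n))"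
    by (simp add: phi_add)
  also have "tri_add (tri_zero n) (tri_zero n :: ('k, 'r) tri) = tri_zero n"
    by (simp add: tri_zero_def tri_add_of)
  also have "\<phi> (tri_zero n) = tri_add (\<phi> (tri_zero n)) (tri_zero n)"
    by (rule tri_carrierE[OF phi_carrier[of "tri_zero n"]]) (simp_all add: tri_zero_def tri_add_of)
  finally show ?thesis
    by - (rule tri_add_left_cancel[of "\<phi> (tri_zero n)" n], simp_all add: phi_carrier)
qed

lemma phi_circ:
  assumes "x \<in> tri_carrier n" "y \<in> tri_carrier n"
  shows "\<phi> (R.tri_circ n x y) = S.tri_circ n (\<phi> x) (\<phi> y)"
proof -
  let ?q = "tri_add (tri_mult scS n (\<phi> x) (\<phi> x)) (tri_mult scS n (\<phi> y) (\<phi> y))"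
  have "tri_add ?q (\<phi> (R.tri_circ n x y)) = \<phi> (tri_mult scR n (tri_add x y) (tri_add x y))"
    using assms
    by (simp add: R.tri_square_add phi_add phi_square tri_add_carrier R.tri_mult_carrier R.tri_circ_carrier)
  also have "\<dots> = tri_add ?q (S.tri_circ n (\<phi> x) (\<phi> y))"
    using assms by (simp add: phi_square tri_add_carrier phi_add S.tri_square_add phi_carrier)
  finally show ?thesis
    using assms
    by - (rule tri_add_left_cancel[of ?q n], simp_all add: phi_carrier tri_add_carrier S.tri_mult_carrier R.tri_circ_carrier S.tri_circ_carrier)
qed

text \<open>The idempotent \<open>p i s\<close> cuts out the part of \<Phi> on which the diagonal
  position i is moved to s.\<close>

definition p :: "nat \<Rightarrow> nat \<Rightarrow> 'k" where
  "p i s = fst (\<phi> (dunit n i)) $ s"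

lemma p_idem:
  assumes "s < n"
  shows "p i s * p i s = p i s"
proof -
  have "\<phi> (dunit n i) = tri_mult scS n (\<phi> (dunit n i)) (\<phi> (dunit n i))"
    using phi_square[of "dunit n i"] by (simp add: R.dunit_square)
  from arg_cong[OF this, of "\<lambda>x. fst x $ s"] show ?thesis
    using assms by (simp add: p_def S.fst_tri_index[where n = n] phi_carrier)
qed

lemma p_column_orth:
  assumes "s < n" "i \<noteq> j"
  shows "p i s * p j s = 0"
proof -
  have "tri_zero n = tri_mult scS n (tri_mult scS n (\<phi> (dunit n i)) (\<phi> (dunit n j))) (\<phi> (dunit n i))"
    using phi_sandwich[of "dunit n i" "dunit n j"] assms by (simp add: R.dunit_orth R.tri_zero_mult phi_zero)
  from arg_cong[OF this, of "\<lambda>x. fst x $ s"] have "p i s * p j s * p i s = 0"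
    using assms by (simp add: p_def S.fst_tri_index[where n = n] phi_carrier S.tri_mult_carrier tri_zero_def)
  moreover have "p i s * p j s * p i s = p i s * p i s * p j s" by (simp only: ac_simps)
  ultimately show ?thesis by (simp add: p_idem assms)
qed

text \<open>With q the entry in question and p = \<open>p i s\<close>, the Jordan product of e_ii
  and e_ij(a) gives 2 p q = q, while e_ii e_ij(a) e_ii = 0 gives p q = 0. No division by 2
  occurs.\<close>

lemma diag_phi_nunit:
  assumes "i < j" "j < n" "s < n"
  shows "fst (\<phi> (nunit n i j a)) $ s = 0"
proof -
  let ?q = "fst (\<phi> (nunit n i j a)) $ s"
  have "S.tri_circ n (\<phi> (dunit n i)) (\<phi> (nunit n i j a)) = \<phi> (nunit n i j a)"
    using assms by (simp add: phi_circ[symmetric] R.tri_circ_dunit_nunit)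
  from arg_cong[OF this, of "\<lambda>x. fst x $ s"] have 1: "p i s * ?q + ?q * p i s = ?q"
    using assms by (simp add: p_def S.fst_tri_index[where n = n] phi_carrier)
  have "tri_zero n = tri_mult scS n (tri_mult scS n (\<phi> (dunit n i)) (\<phi> (nunit n i j a))) (\<phi> (dunit n i))"
    using phi_sandwich[of "dunit n i" "nunit n i j a"] assms by (simp add: R.tri_sandwich_dunit_nunit phi_zero)
  from arg_cong[OF this, of "\<lambda>x. fst x $ s"] have 2: "p i s * ?q * p i s = 0"
    using assms by (simp add: p_def S.fst_tri_index[where n = n] phi_carrier S.tri_mult_carrier tri_zero_def)
  have "p i s * ?q * p i s = p i s * p i s * ?q" by (simp only: ac_simps)
  then have "p i s * ?q = 0" using 2 p_idem assms by simp
  then show ?thesis using 1 by (simp add: mult.commute)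
qed

lemma diag_phi:
  assumes "x \<in> tri_carrier n" "s < n"
  shows "fst (\<phi> x) $ s = (\<Sum>k<n. fst x $ k * p k s)"
proof -
  have "fst (\<phi> x) $ s = (\<Sum>k<n. fst (\<phi> (tri_scale scR (fst x $ k) (dunit n k))) $ s) +
    (\<Sum>(i, j) | i < j \<and> j < n. fst (\<phi> (nunit n i j (snd x $$ (i, j)))) $ s)"
    using assms
    by (intro additive_tri_decomp[OF R.unital_algebra_axioms]) (simp_all add: phi_add S.fst_tri_index[where n = n] phi_carrier)
  also have "(\<Sum>(i, j) | i < j \<and> j < n. fst (\<phi> (nunit n i j (snd x $$ (i, j)))) $ s) = 0"
    using assms(2) by (intro sum.neutral) (auto simp: diag_phi_nunit)
  finally show ?thesis
    using assms(2) by (simp add: phi_scale S.fst_tri_index[where n = n] phi_carrier p_def)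
qed

text \<open>By surjectivity 1 is a combination of the entries of column s; each of these is fixed by
  multiplication with the column sum, which therefore equals 1.\<close>

lemma p_column_sum:
  assumes "s < n"
  shows "(\<Sum>i<n. p i s) = 1"
proof -
  obtain x where x: "x \<in> tri_carrier n" "\<phi> x = tri_of n (\<lambda>_. 1) (\<lambda>_ _. 0)"
    by (rule phi_surj[OF tri_of_carrier])
  have one: "(\<Sum>k<n. fst x $ k * p k s) = 1"
    using diag_phi[OF x(1) assms] x(2) assms by simp
  have "fst x $ k * p k s * (\<Sum>i<n. p i s) = fst x $ k * p k s" if "k < n" for k
  proof -
    have "(\<Sum>i<n. p k s * p i s) = (\<Sum>i<n. if i = k then p k s else 0)"
      using assms by (intro sum.cong) (auto simp: p_idem p_column_orth)
    then have "p k s * (\<Sum>i<n. p i s) = p k s"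
      using that by (simp add: sum.delta sum_distrib_left)
    then show ?thesis by (simp add: mult.assoc)
  qed
  then have "(\<Sum>k<n. fst x $ k * p k s) * (\<Sum>i<n. p i s) = (\<Sum>k<n. fst x $ k * p k s)"
    by (simp add: sum_distrib_right[of _ _ "sum _ _"])
  then show ?thesis using one by simp
qed

text \<open>Let x be a preimage of e_aa with i-th diagonal entry c. Multiplying the diagonal of
  \<open>\<phi> x\<close> at s by \<open>p i s\<close> isolates c, so c fixes \<open>p i a\<close>
  and annihilates \<open>p i b\<close>.\<close>

lemma p_row_orth:
  assumes "i < n" "a < n" "b < n" "a \<noteq> b"
  shows "p i a * p i b = 0"
proof -
  obtain x where x: "x \<in> tri_carrier n" "\<phi> x = tri_of n (\<lambda>k. if k = a then 1 else 0) (\<lambda>_ _. 0)"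
    by (rule phi_surj[OF tri_of_carrier])
  have pick: "p i s * fst (\<phi> x) $ s = p i s * fst x $ i" if "s < n" for s
  proof -
    have "p i s * fst (\<phi> x) $ s = (\<Sum>k<n. p i s * (fst x $ k * p k s))"
      unfolding diag_phi[OF x(1) that] by (rule sum_distrib_left)
    also have "\<dots> = (\<Sum>k<n. if k = i then p i s * fst x $ i else 0)"
    proof (rule sum.cong)
      fix k
      have "p i s * (fst x $ k * p k s) = fst x $ k * (p i s * p k s)" by (simp only: ac_simps)
      then show "p i s * (fst x $ k * p k s) = (if k = i then p i s * fst x $ i else 0)"
        using that by (auto simp: p_idem p_column_orth mult.commute)
    qed simp
    finally show ?thesis using assms(1) by (simp add: sum.delta)
  qed
  have "p i a = p i a * fst x $ i" using pick[OF assms(2)] x assms(2) by simp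
  then have "p i a * p i b = p i a * fst x $ i * p i b" by simp
  also have "\<dots> = p i a * (p i b * fst x $ i)" by (simp only: ac_simps)
  also have "\<dots> = 0" using pick[OF assms(3)] x assms by simp
  finally show ?thesis .
qed

subsection \<open>Simultaneous diagonalisation of the images of the diagonal idempotents\<close>

lemma mat_closed [simp]:
  "A \<in> carrier_mat n n \<Longrightarrow> B \<in> carrier_mat n n \<Longrightarrow> A * B \<in> carrier_mat n n"
  by (rule mult_carrier_mat)

lemmas mat_assoc = assoc_mult_mat[of _ n n _ n _ n]
lemmas mat_distrib = add_mult_distrib_mat[of _ n n _ _ n] mult_add_distrib_mat[of _ n n _ n]

definition F :: "('k, 'r) tri \<Rightarrow> 's mat" where
  "F x = full_mat scS n (\<phi> x)"

lemma F_carrier [simp]: "F x \<in> carrier_mat n n"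
  by (simp add: F_def)

lemma F_dim [simp]: "dim_row (F x) = n" "dim_col (F x) = n"
  by (simp_all add: F_def full_mat_def)

lemma F_upper: "x \<in> tri_carrier n \<Longrightarrow> upper_triangular (F x)"
  using phi_carrier[of x] by (auto simp: F_def full_mat_def tri_carrier_def)

lemma F_diag: "s < n \<Longrightarrow> F x $$ (s, s) = scS (fst (\<phi> x) $ s) 1"
  by (simp add: F_def full_mat_index)

lemma F_add: "x \<in> tri_carrier n \<Longrightarrow> y \<in> tri_carrier n \<Longrightarrow> F (tri_add x y) = F x + F y"
  by (simp add: F_def phi_add S.full_mat_add phi_carrier)

lemma F_scale: "x \<in> tri_carrier n \<Longrightarrow> F (tri_scale scR c x) = map_mat (scS c) (F x)"
  by (simp add: F_def phi_scale S.full_mat_scale phi_carrier)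

lemma F_circ:
  "x \<in> tri_carrier n \<Longrightarrow> y \<in> tri_carrier n \<Longrightarrow> F (R.tri_circ n x y) = F x * F y + F y * F x"
  by (simp add: F_def phi_circ S.tri_circ_def S.full_mat_add S.full_mat_mult phi_carrier S.tri_mult_carrier)

lemma F_zero: "F (tri_zero n) = 0\<^sub>m n n"
  unfolding F_def phi_zero by (auto simp: tri_zero_def full_mat_def intro!: eq_matI)

lemma F_dunit_idem: "F (dunit n i) * F (dunit n i) = F (dunit n i)"
proof -
  have "\<phi> (dunit n i) = tri_mult scS n (\<phi> (dunit n i)) (\<phi> (dunit n i))"
    using phi_square[of "dunit n i"] by (simp add: R.dunit_square)
  then show ?thesis
    unfolding F_def by (metis S.full_mat_mult phi_carrier unit_carrier(1))
qed

lemma F_dunit_orth: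
  assumes "i \<noteq> j"
  shows "F (dunit n i) * F (dunit n j) = 0\<^sub>m n n"
proof (rule orthogonal_idempotents_mat[OF F_carrier F_carrier F_dunit_idem])
  have "R.tri_circ n (dunit n i) (dunit n j) = tri_zero n"
    using assms by (simp add: R.tri_circ_def R.dunit_orth) (simp add: tri_zero_def tri_add_of)
  then show "F (dunit n i) * F (dunit n j) + F (dunit n j) * F (dunit n i) = 0\<^sub>m n n"
    by (metis F_circ F_zero unit_carrier(1))
  have "tri_mult scR n (tri_mult scR n (dunit n i) (dunit n j)) (dunit n i) = tri_zero n"
    using assms by (simp add: R.dunit_orth R.tri_zero_mult)
  then have "tri_zero n = tri_mult scS n (tri_mult scS n (\<phi> (dunit n i)) (\<phi> (dunit n j))) (\<phi> (dunit n i))"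
    using phi_sandwich[of "dunit n i" "dunit n j"] by (simp add: phi_zero)
  then have "full_mat scS n (tri_zero n) = F (dunit n i) * F (dunit n j) * F (dunit n i)"
    by (simp add: F_def S.full_mat_mult phi_carrier S.tri_mult_carrier)
  moreover have "full_mat scS n (tri_zero n) = 0\<^sub>m n n"
    using F_zero by (simp add: F_def phi_zero)
  ultimately show "F (dunit n i) * F (dunit n j) * F (dunit n i) = 0\<^sub>m n n" by simp
qed

lemma F_dunit_mult_index:
  assumes "s < n" "t < n"
  shows "(\<Sum>k<n. F (dunit n i) $$ (s, k) * F (dunit n j) $$ (k, t)) =
    (if i = j then F (dunit n i) $$ (s, t) else 0)"
  using mult_mat_index[of "F (dunit n i)" n "F (dunit n j)" s t] assms
  by (auto simp: F_dunit_idem F_dunit_orth simp del: index_mult_mat(1))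

text \<open>
  With \<open>E i = F (dunit n i)\<close> and \<open>\<Delta> i = diag (p i 0, \<dots>, p i (n - 1))\<close>, the conjugating matrix is
  \<open>g = \<Sum>i. E i \<Delta> i\<close>. Orthogonality of the \<open>E i\<close> and of the \<open>\<Delta> i\<close> gives \<open>E i g = E i \<Delta> i = g \<Delta> i\<close>, and
  orthogonality of the entries of each row of \<open>p\<close> makes \<open>g' = \<Sum>i. \<Delta> i E i\<close> a left inverse of \<open>g\<close>.
\<close>

definition g :: "'s mat" where
  "g = mat n n (\<lambda>(s, t). \<Sum>i<n. scS (p i t) (F (dunit n i) $$ (s, t)))"

definition g' :: "'s mat" where
  "g' = mat n n (\<lambda>(s, t). \<Sum>i<n. scS (p i s) (F (dunit n i) $$ (s, t)))"

lemma g_carrier [simp]: "g \<in> carrier_mat n n" "g' \<in> carrier_mat n n"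
  by (simp_all add: g_def g'_def)

lemma g_UT: "g \<in> UT n" "upper_triangular g'"
proof -
  have u: "F (dunit n i) $$ (s, t) = 0" if "t < s" "s < n" for i s t
    using upper_triangularD[OF F_upper[of "dunit n i"]] that by simp
  have "(\<Sum>i<n. scS (p i s) (F (dunit n i) $$ (s, s))) = 1" if "s < n" for s
  proof -
    have "(\<Sum>i<n. scS (p i s) (F (dunit n i) $$ (s, s))) = (\<Sum>i<n. scS (p i s) 1)"
      using that by (intro sum.cong) (simp_all add: F_diag p_def[symmetric] S.scale_scale p_idem)
    then show ?thesis using that by (simp add: S.scale_sum_left[symmetric] p_column_sum S.scale_one)
  qed
  then show "g \<in> UT n" "upper_triangular g'"
    using u by (auto simp: UT_def g_def g'_def intro!: sum.neutral)
qed

lemma g'_g: "g' * g = 1\<^sub>m n"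
proof (rule eq_matI)
  fix s t assume "s < dim_row (1\<^sub>m n :: 's mat)" "t < dim_col (1\<^sub>m n :: 's mat)"
  then have st: "s < n" "t < n" by simp_all
  have "(g' * g) $$ (s, t) = (\<Sum>k<n. g' $$ (s, k) * g $$ (k, t))"
    using st by (intro mult_mat_index) simp_all
  also have "\<dots> = (\<Sum>k<n. \<Sum>i<n. \<Sum>j<n.
      scS (p i s * p j t) (F (dunit n i) $$ (s, k) * F (dunit n j) $$ (k, t)))"
    using st by (intro sum.cong) (simp_all add: g_def g'_def sum_product S.scale_mult_scale)
  also have "\<dots> = (\<Sum>i<n. \<Sum>k<n. \<Sum>j<n.
      scS (p i s * p j t) (F (dunit n i) $$ (s, k) * F (dunit n j) $$ (k, t)))"
    by (rule sum.swap)
  also have "\<dots> = (\<Sum>i<n. \<Sum>j<n. \<Sum>k<n.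
      scS (p i s * p j t) (F (dunit n i) $$ (s, k) * F (dunit n j) $$ (k, t)))"
    by (rule sum.cong[OF refl], rule sum.swap)
  also have "\<dots> = (\<Sum>i<n. \<Sum>j<n. if j = i then scS (p i s * p i t) (F (dunit n i) $$ (s, t)) else 0)"
    using st by (intro sum.cong refl) (auto simp: S.scale_sum_right[symmetric] F_dunit_mult_index)
  also have "\<dots> = (\<Sum>i<n. scS (p i s * p i t) (F (dunit n i) $$ (s, t)))"
    by (simp add: sum.delta)
  also have "\<dots> = (1\<^sub>m n :: 's mat) $$ (s, t)"
  proof (cases "s = t")
    case True
    have "(\<Sum>i<n. scS (p i s * p i t) (F (dunit n i) $$ (s, t))) = (\<Sum>i<n. scS (p i s) 1)"
      using st True
      by (intro sum.cong) (simp_all add: F_diag p_def[symmetric] S.scale_scale p_idem)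
    then show ?thesis
      using st True by (simp add: S.scale_sum_left[symmetric] p_column_sum S.scale_one)
  qed (use st in \<open>simp add: p_row_orth\<close>)
  finally show "(g' * g) $$ (s, t) = (1\<^sub>m n :: 's mat) $$ (s, t)" .
qed (auto simp: g_def g'_def)

text \<open>S is not commutative, so the left inverse has to be shown to be a right inverse: (g g' -
  1) g = 0, and g is cancelled on the right.\<close>

lemma g_g': "g * g' = 1\<^sub>m n"
proof -
  have c: "g * g' \<in> carrier_mat n n" "(1\<^sub>m n :: 's mat) \<in> carrier_mat n n"
    by simp_all
  have "(g * g' - 1\<^sub>m n) * g = g * g' * g - 1\<^sub>m n * g"
    using c by (intro minus_mult_distrib_mat[of _ n n _ _ n]) simp_all
  also have "g * g' * g = g * (g' * g)" by (simp add: mat_assoc)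
  finally have "(g * g' - 1\<^sub>m n) * g = 0\<^sub>m n n" by (simp add: g'_g one_mat_mult)
  then have z: "g * g' - 1\<^sub>m n = 0\<^sub>m n n"
    by - (rule unitriangular_right_cancel[of _ n g], simp_all add: minus_carrier_mat c g_UT)
  show ?thesis
  proof (rule eq_matI)
    fix i j assume "i < dim_row (1\<^sub>m n :: 's mat)" "j < dim_col (1\<^sub>m n :: 's mat)"
    then show "(g * g') $$ (i, j) = (1\<^sub>m n :: 's mat) $$ (i, j)"
      using arg_cong[OF z, of "\<lambda>A. A $$ (i, j)"] c by (simp del: index_mult_mat(1) index_one_mat(1))
  qed (use carrier_matD[OF c(1)] in simp_all)
qed

section \<open>The conjugated image, in which the diagonal idempotents become diagonal
  matrices\<close>

definition K :: "('k, 'r) tri \<Rightarrow> 's mat" where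
  "K x = g' * F x * g"

lemma K_carrier [simp]: "K x \<in> carrier_mat n n"
  by (simp add: K_def)

lemma K_dim [simp]: "dim_row (K x) = n" "dim_col (K x) = n"
  using K_carrier[of x] by (simp_all only: carrier_matD)

lemma K_F: "F x = g * K x * g'"
proof -
  have "g * K x * g' = (g * g') * F x * (g * g')"
    by (simp add: K_def mat_assoc)
  then show ?thesis by (simp add: g_g' one_mat_mult)
qed

lemma K_upper: "x \<in> tri_carrier n \<Longrightarrow> upper_triangular (K x)"
  unfolding K_def using g_UT F_upper[of x]
  by (intro upper_triangular_mult[of _ n]) (simp_all add: UT_def)

lemma K_add:
  "x \<in> tri_carrier n \<Longrightarrow> y \<in> tri_carrier n \<Longrightarrow> K (tri_add x y) = K x + K y"
  by (simp add: K_def F_add mat_distrib)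

lemma K_scale:
  assumes "x \<in> tri_carrier n"
  shows "K (tri_scale scR c x) = map_mat (scS c) (K x)"
proof (rule eq_matI)
  fix s t assume "s < dim_row (map_mat (scS c) (K x))" "t < dim_col (map_mat (scS c) (K x))"
  then have st: "s < n" "t < n" by simp_all
  have "K y $$ (s, t) = (\<Sum>k<n. \<Sum>l<n. g' $$ (s, l) * F y $$ (l, k) * g $$ (k, t))" for y
    using st by (simp add: K_def mult_mat_index[of _ n] sum_distrib_right del: index_mult_mat(1))
  then show "K (tri_scale scR c x) $$ (s, t) = map_mat (scS c) (K x) $$ (s, t)"
    using assms st by (simp add: F_scale S.scale_sum_right S.scale_mult_left S.scale_mult_right)
qed auto

lemma K_circ:
  assumes "x \<in> tri_carrier n" "y \<in> tri_carrier n"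
  shows "K (R.tri_circ n x y) = K x * K y + K y * K x"
proof -
  have m: "K x * K y = g' * (F x * F y) * g" for x y
  proof -
    have "K x * K y = g' * F x * ((g * g') * F y * g)"
      by (simp add: K_def mat_assoc)
    then show ?thesis by (simp add: g_g' one_mat_mult mat_assoc)
  qed
  show ?thesis
    unfolding m using assms by (simp add: K_def F_circ mat_distrib)
qed

lemma K_dunit: "K (dunit n i) = mat_diag n (\<lambda>s. scS (p i s) 1)" if "i < n"
proof -
  have "F (dunit n i) * g = g * mat_diag n (\<lambda>s. scS (p i s) 1)"
  proof (rule eq_matI)
    fix s t assume "s < dim_row (g * mat_diag n (\<lambda>s. scS (p i s) 1))" "t < dim_col (g * mat_diag n (\<lambda>s. scS (p i s) 1))"
    then have st: "s < n" "t < n" using g_carrier by (auto simp: mat_diag_def)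
    have "(F (dunit n i) * g) $$ (s, t) = (\<Sum>k<n. \<Sum>j<n. scS (p j t) (F (dunit n i) $$ (s, k) * F (dunit n j) $$ (k, t)))"
      using st
      by (simp add: mult_mat_index[of _ n] g_def sum_distrib_left S.scale_mult_right del: index_mult_mat(1))
    also have "\<dots> = (\<Sum>j<n. \<Sum>k<n. scS (p j t) (F (dunit n i) $$ (s, k) * F (dunit n j) $$ (k, t)))"
      by (rule sum.swap)
    also have "\<dots> = (\<Sum>j<n. if j = i then scS (p i t) (F (dunit n i) $$ (s, t)) else 0)"
      using st by (intro sum.cong) (auto simp: S.scale_sum_right[symmetric] F_dunit_mult_index)
    also have "\<dots> = scS (p i t) (F (dunit n i) $$ (s, t))" using that by (simp add: sum.delta)
    \<comment> \<open>The sum is reintroduced with all terms but one zero: by column orthogonality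
      the factor \<open>p i t\<close> selects the i-th term of the sum defining
      \<open>g\<close>.\<close>
    also have "\<dots> = (\<Sum>j<n. if j = i then scS (p i t) (F (dunit n i) $$ (s, t)) else 0)"
      using that by (simp add: sum.delta)
    also have "\<dots> = (\<Sum>j<n. scS (p i t) (scS (p j t) (F (dunit n j) $$ (s, t))))"
      using st by (intro sum.cong) (auto simp: S.scale_scale p_idem p_column_orth)
    also have "\<dots> = g $$ (s, t) * scS (p i t) 1"
      using st by (simp add: g_def S.scale_sum_right S.scale_mult_right)
    finally show "(F (dunit n i) * g) $$ (s, t) = (g * mat_diag n (\<lambda>s. scS (p i s) 1)) $$ (s, t)"
      using st by (simp add: mat_diag_mult_right[of _ n n] del: index_mult_mat(1))
  qed (use carrier_matD[OF g_carrier(1)] in \<open>simp_all add: mat_diag_def\<close>)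
  then have "K (dunit n i) = g' * (g * mat_diag n (\<lambda>s. scS (p i s) 1))"
    by (simp add: K_def mat_assoc)
  also have "\<dots> = g' * g * mat_diag n (\<lambda>s. scS (p i s) 1)"
    by (simp add: mat_assoc)
  finally show ?thesis by (simp add: g'_g one_mat_mult)
qed

text \<open>\<open>K x\<close> retains only the images in S of diagonal entries, so the vanishing of
  the \<Phi>-diagonal is assumed separately; injectivity of \<phi> does the rest.\<close>

lemma K_faithful:
  assumes "x \<in> tri_carrier n" "K x = 0\<^sub>m n n" "\<And>s. s < n \<Longrightarrow> fst (\<phi> x) $ s = 0"
  shows "x = tri_zero n"
proof (rule phi_inj)
  have "F x = 0\<^sub>m n n" using K_F[of x] assms(2) by (simp add: right_mult_zero_mat[of _ n n] left_mult_zero_mat[of _ n n])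
  moreover have "F x $$ (i, j) = snd (\<phi> x) $$ (i, j)" if "i < j" "j < n" for i j
    using that by (simp add: F_def full_mat_index)
  ultimately have "snd (\<phi> x) $$ (i, j) = 0" if "i < j" "j < n" for i j
    using that by simp
  then show "\<phi> x = \<phi> (tri_zero n)"
    unfolding phi_zero using assms
    by (intro tri_eqI[of _ n]) (simp_all add: phi_carrier, simp_all add: tri_zero_def)
qed (use assms in auto)

subsection \<open>Peirce components\<close>

text \<open>The Jordan product of e_kk and e_ij(a) is e_ij(a); since \<open>K (dunit n k)\<close> is
  diagonal, this product acts on each entry by a scalar.\<close>

lemma K_nunit_weight:
  assumes "i < j" "j < n" "s < n" "t < n" "k = i \<or> k = j"
  shows "K (nunit n i j a) $$ (s, t) = scS (p k s + p k t) (K (nunit n i j a) $$ (s, t))"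
proof -
  let ?X = "K (nunit n i j a)"
  have k: "k < n" using assms by auto
  have "?X = mat_diag n (\<lambda>s. scS (p k s) 1) * ?X + ?X * mat_diag n (\<lambda>s. scS (p k s) 1)"
    using K_circ[of "dunit n k" "nunit n i j a"] assms k by (simp add: R.tri_circ_dunit_nunit K_dunit)
  also have "\<dots> $$ (s, t) = scS (p k s) 1 * ?X $$ (s, t) + ?X $$ (s, t) * scS (p k t) 1"
    using assms(3,4) by (simp add: mat_diag_mult_left[of _ n n] mat_diag_mult_right[of _ n n] del: index_mult_mat(1))
  finally show ?thesis
    by (simp add: S.scale_mult_left S.scale_mult_right S.scale_add_left)
qed

text \<open>Combine the weights for k = i and k = j. Products inside one column vanish, and what
  remains says that the entry (s, t) lives on the part where {i, j} is moved onto {s, t}.\<close>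

lemma K_nunit_support:
  assumes "i < j" "j < n" "s < n" "t < n"
  shows "K (nunit n i j a) $$ (s, t) = scS (p i s * p j t + p j s * p i t) (K (nunit n i j a) $$ (s, t))"
proof -
  have "K (nunit n i j a) $$ (s, t) = scS ((p i s + p i t) * (p j s + p j t)) (K (nunit n i j a) $$ (s, t))"
    using K_nunit_weight[OF assms, of i a] K_nunit_weight[OF assms, of j a] by (simp add: S.scale_scale[symmetric])
  also have "(p i s + p i t) * (p j s + p j t) = p i s * p j t + p j s * p i t"
    using assms p_column_orth[of s i j] p_column_orth[of t i j] by (simp add: algebra_simps)
  finally show ?thesis .
qed

lemma K_nunit_lower:
  assumes "i < j" "j < n" "s < n" "t \<le> s"
  shows "K (nunit n i j a) $$ (s, t) = 0"
proof (cases "t = s")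
  case True
  then show ?thesis
    using K_nunit_support[of i j s t a] assms p_column_orth[of s i j] by (simp add: mult.commute[of "p j s"])
qed (use upper_triangularD[OF K_upper[of "nunit n i j a"], of t s] assms in simp)

lemma K_nunit_mult:
  assumes "i < j" "j < k" "k < n" "s < n" "t < n"
  shows "K (nunit n i k (a * b)) $$ (s, t) =
    (\<Sum>m<n. K (nunit n i j a) $$ (s, m) * K (nunit n j k b) $$ (m, t)) +
    (\<Sum>m<n. K (nunit n j k b) $$ (s, m) * K (nunit n i j a) $$ (m, t))"
proof -
  have "K (nunit n i k (a * b)) =
      K (nunit n i j a) * K (nunit n j k b) + K (nunit n j k b) * K (nunit n i j a)"
    using assms K_circ[of "nunit n i j a" "nunit n j k b"] by (simp add: R.tri_circ_nunit)
  then show ?thesis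
    using assms by (simp add: mult_mat_index[of _ n] del: index_mult_mat(1))
qed

lemma K_nunit_scale: "K (nunit n i j (scR c a)) = map_mat (scS c) (K (nunit n i j a))"
  by (simp add: R.tri_scale_nunit[symmetric] K_scale)

lemma K_nunit_add: "K (nunit n i j (a + b)) = K (nunit n i j a) + K (nunit n i j b)"
  by (simp add: nunit_add K_add)

lemma K_nunit_eq_zero:
  assumes "i < j" "j < n" "K (nunit n i j a) = 0\<^sub>m n n"
  shows "a = 0"
  using K_faithful[of "nunit n i j a"] assms
  by (intro nunit_eq_zero[where 'k = 'k, of i j n a]) (simp_all add: diag_phi_nunit)

text \<open>
  On the part of \<open>\<Phi>\<close> cut out by \<open>p i a * p j b * p k c\<close> the diagonal positions \<open>i, j, k\<close> move to
  \<open>a, b, c\<close>. If \<open>b\<close> does not lie between \<open>a\<close> and \<open>c\<close>, the Jordan product of the images of the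
  \<open>(i, j)\<close> and \<open>(j, k)\<close> components vanishes there, although it has to be the image of the
  \<open>(i, k)\<close> component, a copy of \<open>R\<close>.
\<close>

lemma p_between:
  assumes ijk: "i < j" "j < k" "k < n" and abc: "a < n" "b < n" "c < n"
    and no: "\<not> (a < b \<and> b < c)" "\<not> (c < b \<and> b < a)"
  shows "p i a * p j b * p k c = 0"
proof -
  define e where "e = p i a * p j b * p k c"
  have "e * e = (p i a * p i a) * (p j b * p j b) * (p k c * p k c)"
    unfolding e_def by (simp only: ac_simps)
  then have ee: "e * e = e" using abc by (simp add: p_idem e_def)
  have orth: "p l u * p l v = (if u = v then p l u else 0)" if "l < n" "u < n" "v < n" for l u v
    using that by (simp add: p_row_orth p_idem)
  \<comment> \<open>On e \<Phi> the image of e_ij(r) can occupy only that one of (a, b) and (b, a)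
    which lies above the diagonal; \<open>Y\<close> is the same for e_jk(r) with b and c.\<close>
  have X: "scS e (K (nunit n i j r) $$ (s, t)) = 0"
    if "s < n" "t < n" "\<not> (s < t \<and> (s = a \<and> t = b \<or> s = b \<and> t = a))" for r s t
  proof (cases "s < t")
    case True
    have "e * (p i s * p j t) = (p i a * p i s) * (p j b * p j t) * p k c"
      "e * (p j s * p i t) = (p i a * p i t) * (p j b * p j s) * p k c"
      unfolding e_def by (simp_all only: ac_simps)
    then have "e * (p i s * p j t + p j s * p i t) = 0"
      using ijk abc that True by (auto simp: orth distrib_left)
    moreover have "scS e (K (nunit n i j r) $$ (s, t)) =
        scS (e * (p i s * p j t + p j s * p i t)) (K (nunit n i j r) $$ (s, t))"
      using K_nunit_support[of i j s t r] ijk that by (simp add: S.scale_scale[symmetric])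
    ultimately show ?thesis by simp
  qed (use K_nunit_lower ijk that in simp)
  have Y: "scS e (K (nunit n j k r) $$ (s, t)) = 0"
    if "s < n" "t < n" "\<not> (s < t \<and> (s = b \<and> t = c \<or> s = c \<and> t = b))" for r s t
  proof (cases "s < t")
    case True
    have "e * (p j s * p k t) = (p j b * p j s) * (p k c * p k t) * p i a"
      "e * (p k s * p j t) = (p j b * p j t) * (p k c * p k s) * p i a"
      unfolding e_def by (simp_all only: ac_simps)
    then have "e * (p j s * p k t + p k s * p j t) = 0"
      using ijk abc that True by (auto simp: orth distrib_left)
    moreover have "scS e (K (nunit n j k r) $$ (s, t)) =
        scS (e * (p j s * p k t + p k s * p j t)) (K (nunit n j k r) $$ (s, t))"
      using K_nunit_support[of j k s t r] ijk that by (simp add: S.scale_scale[symmetric])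
    ultimately show ?thesis by simp
  qed (use K_nunit_lower ijk that in simp)
  have split: "scS e (x * y) = scS e x * scS e y" for x y
    by (simp add: S.scale_mult_scale ee)
  have "scR e r = 0" for r
  proof -
    have "K (nunit n i k (scR e r)) = 0\<^sub>m n n"
    proof (rule eq_matI)
      fix s t assume "s < dim_row (0\<^sub>m n n :: 's mat)" "t < dim_col (0\<^sub>m n n :: 's mat)"
      then have st: "s < n" "t < n" by simp_all
      \<comment> \<open>The second factor carries 1, so that r * 1 exhibits an arbitrary r. A
        nonzero term needs s < m < t, hence m = b with a and c on its two sides, which is
        excluded.\<close>
      let ?X = "K (nunit n i j r)" and ?Y = "K (nunit n j k 1)"
      have "scS e (?X $$ (s, m)) * scS e (?Y $$ (m, t)) = 0" if m: "m < n" for m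
      proof (cases "s < m \<and> (s = a \<and> m = b \<or> s = b \<and> m = a)")
        case True
        then have "\<not> (m < t \<and> (m = b \<and> t = c \<or> m = c \<and> t = b))" using no by auto
        then show ?thesis using Y[of m t 1] m st by simp
      qed (use X[of s m r] m st in simp)
      moreover have "scS e (?Y $$ (s, m)) * scS e (?X $$ (m, t)) = 0" if m: "m < n" for m
      proof (cases "s < m \<and> (s = b \<and> m = c \<or> s = c \<and> m = b)")
        case True
        then have "\<not> (m < t \<and> (m = a \<and> t = b \<or> m = b \<and> t = a))" using no by auto
        then show ?thesis using X[of m t r] m st by simp
      qed (use Y[of s m 1] m st in simp)
      ultimately have "scS e (K (nunit n i k (r * 1)) $$ (s, t)) = 0"
        unfolding K_nunit_mult[OF ijk st] by (simp add: S.scale_add_right S.scale_sum_right split)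
      then show "K (nunit n i k (scR e r)) $$ (s, t) = (0\<^sub>m n n :: 's mat) $$ (s, t)"
        using st by (simp add: K_nunit_scale)
    qed simp_all
    then show ?thesis using K_nunit_eq_zero[of i k "scR e r"] ijk by simp
  qed
  then have "e = 0" using no_killing_idempotent ee by blast
  then show ?thesis by (simp add: e_def)
qed

text \<open>This rests on injectivity: the complement c of the row sum annihilates row i, hence the
  image of c e_ii, so c e_ii = 0 and c = 0.\<close>

lemma p_row_sum:
  assumes "i < n"
  shows "(\<Sum>a<n. p i a) = 1"
proof -
  define c where "c = 1 - (\<Sum>a<n. p i a)"
  have cp: "c * p i s = 0" if "s < n" for s
  proof -
    have "(\<Sum>a<n. p i a * p i s) = (\<Sum>a<n. if a = s then p i s else 0)"
      using assms that by (intro sum.cong) (auto simp: p_idem p_row_orth)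
    then show ?thesis using that by (simp add: c_def left_diff_distrib sum_distrib_right sum.delta)
  qed
  have "tri_scale scR c (dunit n i) = tri_zero n"
  proof (rule K_faithful)
    show "K (tri_scale scR c (dunit n i)) = 0\<^sub>m n n"
      using assms
      by (auto simp: K_scale K_dunit mat_diag_def S.scale_scale cp intro!: eq_matI)
    show "fst (\<phi> (tri_scale scR c (dunit n i))) $ s = 0" if "s < n" for s
      using that cp[OF that]
      by (simp add: phi_scale S.fst_tri_index[where n = n] phi_carrier p_def)
  qed (simp add: R.tri_scale_carrier)
  from arg_cong[OF this, of "\<lambda>x. fst x $ i"] have "c = 0"
    using assms by (simp add: R.fst_tri_index[where n = n]) (simp add: dunit_def tri_zero_def)
  then show ?thesis by (simp add: c_def)
qed

end

subsection \<open>The homomorphic and the antihomomorphic summand\<close>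

locale tri_jordan_iso_split = tri_jordan_iso +
  fixes h
  assumes hh: "h * h = h"
    and h_p: "\<And>i a. i < n \<Longrightarrow> a < n \<Longrightarrow> h * p i a = (if a = i then h else 0)"
    and h'_p: "\<And>i a. i < n \<Longrightarrow> a < n \<Longrightarrow> (1 - h) * p i a = (if a = n - 1 - i then 1 - h else 0)"
begin

lemma h'h': "(1 - h) * (1 - h) = 1 - h" and hh': "h * (1 - h) = 0" and h'h: "(1 - h) * h = 0"
  by (simp_all add: algebra_simps hh)

definition f1 :: "nat \<Rightarrow> nat \<Rightarrow> 'b \<Rightarrow> 'c" where
  "f1 i j a = scS h (K (nunit n i j a) $$ (i, j))"

text \<open>On (1 - h) \<Phi> the position (i, j) is reflected in the antidiagonal, which keeps it
  above the diagonal.\<close>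

definition f2 :: "nat \<Rightarrow> nat \<Rightarrow> 'b \<Rightarrow> 'c" where
  "f2 i j a = scS (1 - h) (K (nunit n i j a) $$ (n - 1 - j, n - 1 - i))"

lemma h_K:
  assumes "i < j" "j < n" "s < n" "t < n"
  shows "scS h (K (nunit n i j a) $$ (s, t)) = (if s = i \<and> t = j then f1 i j a else 0)"
proof (cases "s < t")
  case True
  \<comment> \<open>Since h is idempotent it may be doubled, so that each factor taken from p meets
    its own h. The swapped term would require s = j and t = i, impossible for s < t.\<close>
  have "h * h * (p i s * p j t) = (h * p i s) * (h * p j t)" "h * h * (p j s * p i t) = (h * p j s) * (h * p i t)"
    by (simp_all only: ac_simps)
  then have "h * (p i s * p j t + p j s * p i t) = (if s = i \<and> t = j then h else 0)"
    using assms True unfolding hh by (auto simp: h_p hh distrib_left)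
  moreover have "scS h (K (nunit n i j a) $$ (s, t)) =
      scS (h * (p i s * p j t + p j s * p i t)) (K (nunit n i j a) $$ (s, t))"
    using K_nunit_support[OF assms, of a] by (simp add: S.scale_scale[symmetric])
  ultimately show ?thesis by (auto simp: f1_def)
qed (use K_nunit_lower assms in auto)

lemma h'_K:
  assumes "i < j" "j < n" "s < n" "t < n"
  shows "scS (1 - h) (K (nunit n i j a) $$ (s, t)) = (if s = n - 1 - j \<and> t = n - 1 - i then f2 i j a else 0)"
proof (cases "s < t")
  case True
  have "(1 - h) * (1 - h) * (p i s * p j t) = ((1 - h) * p i s) * ((1 - h) * p j t)"
    "(1 - h) * (1 - h) * (p j s * p i t) = ((1 - h) * p j s) * ((1 - h) * p i t)"
    by (simp_all only: ac_simps)
  then have "(1 - h) * (p i s * p j t + p j s * p i t) = (if s = n - 1 - j \<and> t = n - 1 - i then 1 - h else 0)"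
    using assms True unfolding h'h' by (auto simp: h'_p h'h' distrib_left)
  moreover have "scS (1 - h) (K (nunit n i j a) $$ (s, t)) =
      scS ((1 - h) * (p i s * p j t + p j s * p i t)) (K (nunit n i j a) $$ (s, t))"
    using K_nunit_support[OF assms, of a] by (simp add: S.scale_scale[symmetric])
  ultimately show ?thesis by (auto simp: f2_def)
qed (use K_nunit_lower assms in auto)

lemma f1_mult:
  assumes "i < j" "j < k" "k < n"
  shows "f1 i k (a * b) = f1 i j a * f1 j k b"
proof -
  have split: "scS h (x * y) = scS h x * scS h y" for x y
    by (simp add: S.scale_mult_scale hh)
  have ite: "(if P then x else 0) * (if P then y else 0) = (if P then x * y else 0)" for P and x y :: 'c
    by simp
  show ?thesis
    using assms unfolding f1_def[of i k]
    by (simp add: K_nunit_mult[of i j k] S.scale_add_right S.scale_sum_right split h_K ite sum.delta)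
qed

text \<open>At the reflected position (n - 1 - k, n - 1 - i) the first sum of
  \<open>K_nunit_mult\<close> vanishes and the second keeps only m = n - 1 - j; for
  \<open>f1\<close> it is the first sum that survives. Hence the reversed order.\<close>

lemma f2_mult:
  assumes "i < j" "j < k" "k < n"
  shows "f2 i k (a * b) = f2 j k b * f2 i j a"
proof -
  have split: "scS (1 - h) (x * y) = scS (1 - h) x * scS (1 - h) y" for x y
    by (simp add: S.scale_mult_scale h'h')
  have "n - 1 - k \<noteq> n - 1 - j" "n - 1 - k < n" "n - 1 - i < n" using assms by auto
  moreover have ite: "(if P then x else 0) * (if P then y else 0) = (if P then x * y else 0)" for P and x y :: 'c
    by simp
  ultimately show ?thesis
    using assms unfolding f2_def[of i k]
    by (simp add: K_nunit_mult[of i j k] S.scale_add_right S.scale_sum_right split h'_K ite sum.delta)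
qed

lemma f_add:
  assumes "i < j" "j < n"
  shows "f1 i j (a + b) = f1 i j a + f1 i j b" "f2 i j (a + b) = f2 i j a + f2 i j b"
  using assms by (simp_all add: f1_def f2_def K_nunit_add S.scale_add_right)

lemma f_scale:
  assumes "i < j" "j < n"
  shows "f1 i j (scR c a) = scS c (f1 i j a)" "f2 i j (scR c a) = scS c (f2 i j a)"
  using assms by (simp_all add: f1_def f2_def K_nunit_scale S.scale_scale mult.commute)

lemma scale_f:
  "scS h (f1 i j a) = f1 i j a" "scS h (f2 i j a) = 0"
  "scS (1 - h) (f2 i j a) = f2 i j a" "scS (1 - h) (f1 i j a) = 0"
  by (simp_all add: f1_def f2_def S.scale_scale hh h'h' hh' h'h)

lemma f_range: "f1 i j a \<in> range (scS h)" "f2 i j a \<in> range (scS (1 - h))"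
  by (simp_all add: f1_def f2_def)

text \<open>Split the contribution of each matrix unit by 1 = h + (1 - h): the h part reaches (s, t)
  only from (s, t), the other part only from the reflected position.\<close>

lemma K_offdiag:
  assumes x: "x \<in> tri_carrier n" and st: "s < t" "t < n"
  shows "K x $$ (s, t) = f1 s t (snd x $$ (s, t)) + f2 (n - 1 - t) (n - 1 - s) (snd x $$ (n - 1 - t, n - 1 - s))"
proof -
  define P where "P = {(i, j). i < j \<and> j < n}"
  have "P \<subseteq> {..<n} \<times> {..<n}" by (auto simp: P_def)
  then have fin: "finite P" by (rule finite_subset) auto
  have "K x $$ (s, t) = (\<Sum>k<n. K (tri_scale scR (fst x $ k) (dunit n k)) $$ (s, t)) +
    (\<Sum>(i, j) | i < j \<and> j < n. K (nunit n i j (snd x $$ (i, j))) $$ (s, t))"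
    using x st by (intro additive_tri_decomp[OF R.unital_algebra_axioms]) (simp_all add: K_add)
  also have "(\<Sum>k<n. K (tri_scale scR (fst x $ k) (dunit n k)) $$ (s, t)) = 0"
    using st by (intro sum.neutral) (simp add: K_scale K_dunit mat_diag_def)
  also have "(\<Sum>(i, j) | i < j \<and> j < n. K (nunit n i j (snd x $$ (i, j))) $$ (s, t)) =
      (\<Sum>q\<in>P. (if q = (s, t) then f1 s t (snd x $$ (s, t)) else 0) +
        (if q = (n - 1 - t, n - 1 - s) then f2 (n - 1 - t) (n - 1 - s) (snd x $$ (n - 1 - t, n - 1 - s)) else 0))"
    unfolding P_def
  proof (rule sum.cong)
    fix q assume "q \<in> {(i, j). i < j \<and> j < n}"
    then obtain i j where q: "q = (i, j)" and ij: "i < j" "j < n" by auto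
    let ?X = "K (nunit n i j (snd x $$ (i, j))) $$ (s, t)"
    have "?X = scS h ?X + scS (1 - h) ?X" by (simp add: S.scale_split)
    also have "scS h ?X = (if q = (s, t) then f1 s t (snd x $$ (s, t)) else 0)"
      using ij st q by (auto simp: h_K)
    also have "s = n - 1 - j \<and> t = n - 1 - i \<longleftrightarrow> q = (n - 1 - t, n - 1 - s)"
      using ij st q by auto
    then have "scS (1 - h) ?X =
        (if q = (n - 1 - t, n - 1 - s) then f2 (n - 1 - t) (n - 1 - s) (snd x $$ (n - 1 - t, n - 1 - s)) else 0)"
      using ij st q by (auto simp: h'_K)
    finally show "(case q of (i, j) \<Rightarrow> K (nunit n i j (snd x $$ (i, j))) $$ (s, t)) =
      (if q = (s, t) then f1 s t (snd x $$ (s, t)) else 0) +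
        (if q = (n - 1 - t, n - 1 - s) then f2 (n - 1 - t) (n - 1 - s) (snd x $$ (n - 1 - t, n - 1 - s)) else 0)"
      by (simp add: q)
  qed simp
  also have "\<dots> = f1 s t (snd x $$ (s, t)) + f2 (n - 1 - t) (n - 1 - s) (snd x $$ (n - 1 - t, n - 1 - s))"
  proof -
    have "(s, t) \<in> P" "(n - 1 - t, n - 1 - s) \<in> P" using st by (auto simp: P_def)
    then show ?thesis by (simp only: sum.distrib sum.delta[OF fin] if_True)
  qed
  finally show ?thesis by simp
qed

lemma K_diag:
  assumes "x \<in> tri_carrier n" "s < n"
  shows "K x $$ (s, s) = scS (fst (\<phi> x) $ s) 1"
proof -
  have "K x $$ (s, s) = (\<Sum>k<n. K (tri_scale scR (fst x $ k) (dunit n k)) $$ (s, s)) +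
    (\<Sum>(i, j) | i < j \<and> j < n. K (nunit n i j (snd x $$ (i, j))) $$ (s, s))"
    using assms by (intro additive_tri_decomp[OF R.unital_algebra_axioms]) (simp_all add: K_add)
  also have "(\<Sum>(i, j) | i < j \<and> j < n. K (nunit n i j (snd x $$ (i, j))) $$ (s, s)) = 0"
    using assms by (intro sum.neutral) (auto simp: K_nunit_lower)
  also have "(\<Sum>k<n. K (tri_scale scR (fst x $ k) (dunit n k)) $$ (s, s)) = scS (fst (\<phi> x) $ s) 1"
    using assms by (simp add: K_scale K_dunit mat_diag_def S.scale_scale diag_phi S.scale_sum_left)
  finally show ?thesis by simp
qed

lemma diag_phi_split:
  assumes "x \<in> tri_carrier n" "s < n"
  shows "fst (\<phi> x) $ s = h * fst x $ s + (1 - h) * fst x $ (n - 1 - s)"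
proof -
  have "fst x $ k * p k s = (if k = s then h * fst x $ s else 0) +
      (if k = n - 1 - s then (1 - h) * fst x $ (n - 1 - s) else 0)" if "k < n" for k
  proof -
    have "fst x $ k * p k s = fst x $ k * (h * p k s) + fst x $ k * ((1 - h) * p k s)"
      by (simp add: algebra_simps)
    moreover have "s = n - 1 - k \<longleftrightarrow> k = n - 1 - s" using that assms by auto
    ultimately show ?thesis using that assms by (simp add: h_p h'_p mult.commute)
  qed
  then have "(\<Sum>k<n. fst x $ k * p k s) = (\<Sum>k<n. (if k = s then h * fst x $ s else 0) +
      (if k = n - 1 - s then (1 - h) * fst x $ (n - 1 - s) else 0))"
    by (intro sum.cong) simp_all
  then show ?thesis
    using assms by (simp add: diag_phi sum.distrib sum.delta)
qed

text \<open>The matrix B with single entry b is moved back through the conjugation: g B g' is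
  strictly upper triangular, so it comes from an element of T(S) with zero \<Phi>-diagonal, and
  surjectivity of \<phi> applies.\<close>

lemma K_entry_surj:
  assumes st: "s < t" "t < n"
  obtains x where "x \<in> tri_carrier n" "K x $$ (s, t) = b"
proof -
  define B where "B = mat n n (\<lambda>(i, j). if i = s \<and> j = t then b else 0)"
  have B: "B \<in> carrier_mat n n" by (simp add: B_def)
  have ent: "(g * B * g') $$ (i, j) = g $$ (i, s) * b * g' $$ (t, j)" if "i < n" "j < n" for i j
  proof -
    have "(g * B * g') $$ (i, j) = (\<Sum>l<n. (\<Sum>k<n. g $$ (i, k) * B $$ (k, l)) * g' $$ (l, j))"
      using that B by (simp add: mult_mat_index[of _ n] del: index_mult_mat(1))
    also have "\<dots> = (\<Sum>l<n. if l = t then g $$ (i, s) * b * g' $$ (t, j) else 0)"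
    proof (rule sum.cong)
      fix l assume l: "l \<in> {..<n}"
      have "(\<Sum>k<n. g $$ (i, k) * B $$ (k, l)) = (\<Sum>k<n. if k = s then (if l = t then g $$ (i, s) * b else 0) else 0)"
        by (rule sum.cong) (use l in \<open>auto simp: B_def\<close>)
      then show "(\<Sum>k<n. g $$ (i, k) * B $$ (k, l)) * g' $$ (l, j) =
          (if l = t then g $$ (i, s) * b * g' $$ (t, j) else 0)"
        using st by (simp add: sum.delta)
    qed simp
    finally show ?thesis using st by (simp add: sum.delta)
  qed
  \<comment> \<open>For j \<le> i either s < i or j \<le> i \<le> s < t, so one of the two outer
    factors in \<open>ent\<close> lies below the diagonal.\<close>
  have low: "(g * B * g') $$ (i, j) = 0" if "i < n" "j < n" "\<not> i < j" for i j
  proof (cases "s < i")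
    case True
    then have "g $$ (i, s) = 0"
      using g_UT(1) upper_triangularD[of g s i] that carrier_matD[OF g_carrier(1)] by (simp add: UT_def)
    then show ?thesis using ent that by simp
  next
    case False
    then have "g' $$ (t, j) = 0"
      using upper_triangularD[OF g_UT(2), of j t] that st carrier_matD[OF g_carrier(2)] by simp
    then show ?thesis using ent that by simp
  qed
  define y where "y = (tri_of n (\<lambda>_. 0) (\<lambda>i j. (g * B * g') $$ (i, j)) :: ('a, 'c) tri)"
  have "y \<in> tri_carrier n" by (simp add: y_def)
  then obtain x where x: "x \<in> tri_carrier n" "\<phi> x = y" by (rule phi_surj)
  have c: "g * B * g' \<in> carrier_mat n n" using B by simp
  have "F x = g * B * g'"
  proof (rule eq_matI)
    fix i j assume "i < dim_row (g * B * g')" "j < dim_col (g * B * g')"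
    then have ij: "i < n" "j < n" using carrier_matD[OF c] by simp_all
    show "F x $$ (i, j) = (g * B * g') $$ (i, j)"
      unfolding F_def x y_def using ij low[OF ij]
      by (auto simp: full_mat_index simp del: index_mult_mat(1))
  qed (use carrier_matD[OF c] in simp_all)
  then have "K x = (g' * g) * B * (g' * g)" using B by (simp add: K_def mat_assoc)
  then have "K x = B" using B by (simp add: g'_g one_mat_mult)
  then show thesis using that x st by (simp add: B_def)
qed

text \<open>For a in h R the matrix \<open>K (nunit n i j a)\<close> is concentrated at (i, j),
  where it equals \<open>f1 i j a\<close>; so faithfulness of \<open>K\<close> gives injectivity.
  For surjectivity, multiplying \<open>K_offdiag\<close> by h discards the \<open>f2\<close>
  part.\<close>

lemma f1_bij:
  assumes ij: "i < j" "j < n"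
  shows "bij_betw (f1 i j) (range (scR h)) (range (scS h))"
  unfolding bij_betw_def
proof (intro conjI)
  show "inj_on (f1 i j) (range (scR h))"
  proof (rule inj_onI)
    fix a b assume "a \<in> range (scR h)" "b \<in> range (scR h)" and eq: "f1 i j a = f1 i j b"
    then obtain a' b' where ab: "a = scR h a'" "b = scR h b'" by auto
    have "a = (a - b) + b" by simp
    then have "f1 i j (a - b) = 0" using eq f_add(1)[OF ij, of "a - b" b] by simp
    moreover have "scR h (a - b) = a - b"
      using ab by (simp add: R.scale_diff_right R.scale_scale hh)
    ultimately have "K (nunit n i j (a - b)) $$ (s, t) = 0" if "s < n" "t < n" for s t
      using arg_cong[OF K_nunit_scale[of i j h "a - b"], of "\<lambda>A. A $$ (s, t)"] h_K[OF ij that] that by simp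
    then have "K (nunit n i j (a - b)) = 0\<^sub>m n n" by (intro eq_matI) simp_all
    then show "a = b" using K_nunit_eq_zero[OF ij, of "a - b"] by simp
  qed
  show "f1 i j ` range (scR h) = range (scS h)"
  proof
    show "f1 i j ` range (scR h) \<subseteq> range (scS h)" using f_range by auto
    show "range (scS h) \<subseteq> f1 i j ` range (scR h)"
    proof
      fix b assume "b \<in> range (scS h)"
      then obtain b' where b: "b = scS h b'" by auto
      obtain x where x: "x \<in> tri_carrier n" "K x $$ (i, j) = b" using K_entry_surj[OF ij] .
      have "b = scS h b" by (simp add: b S.scale_scale hh)
      also have "\<dots> = f1 i j (snd x $$ (i, j))"
        using K_offdiag[OF x(1) ij] x(2) by (simp add: S.scale_add_right scale_f)
      also have "\<dots> = f1 i j (scR h (snd x $$ (i, j)))"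
        using ij by (simp add: f_scale scale_f)
      finally show "b \<in> f1 i j ` range (scR h)" by auto
    qed
  qed
qed

lemma f2_bij:
  assumes ij: "i < j" "j < n"
  shows "bij_betw (f2 i j) (range (scR (1 - h))) (range (scS (1 - h)))"
  unfolding bij_betw_def
proof (intro conjI)
  show "inj_on (f2 i j) (range (scR (1 - h)))"
  proof (rule inj_onI)
    fix a b assume "a \<in> range (scR (1 - h))" "b \<in> range (scR (1 - h))" and eq: "f2 i j a = f2 i j b"
    then obtain a' b' where ab: "a = scR (1 - h) a'" "b = scR (1 - h) b'" by auto
    have "a = (a - b) + b" by simp
    then have "f2 i j (a - b) = 0" using eq f_add(2)[OF ij, of "a - b" b] by simp
    moreover have "scR (1 - h) (a - b) = a - b"
      using ab by (simp add: R.scale_diff_right R.scale_scale h'h')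
    ultimately have "K (nunit n i j (a - b)) $$ (s, t) = 0" if "s < n" "t < n" for s t
      using arg_cong[OF K_nunit_scale[of i j "1 - h" "a - b"], of "\<lambda>A. A $$ (s, t)"] h'_K[OF ij that] that
      by simp
    then have "K (nunit n i j (a - b)) = 0\<^sub>m n n" by (intro eq_matI) simp_all
    then show "a = b" using K_nunit_eq_zero[OF ij, of "a - b"] by simp
  qed
  show "f2 i j ` range (scR (1 - h)) = range (scS (1 - h))"
  proof
    show "f2 i j ` range (scR (1 - h)) \<subseteq> range (scS (1 - h))" using f_range by auto
    show "range (scS (1 - h)) \<subseteq> f2 i j ` range (scR (1 - h))"
    proof
      fix b assume "b \<in> range (scS (1 - h))"
      then obtain b' where b: "b = scS (1 - h) b'" by auto
      have ij': "n - 1 - j < n - 1 - i" "n - 1 - i < n" "n - 1 - (n - 1 - i) = i" "n - 1 - (n - 1 - j) = j"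
        using ij by auto
      obtain x where x: "x \<in> tri_carrier n" "K x $$ (n - 1 - j, n - 1 - i) = b"
        using K_entry_surj[OF ij'(1,2)] .
      have "b = scS (1 - h) b" by (simp add: b S.scale_scale h'h')
      also have "\<dots> = f2 i j (snd x $$ (i, j))"
        using arg_cong[OF K_offdiag[OF x(1) ij'(1,2)], of "scS (1 - h)"] unfolding ij' x(2)
        by (simp only: S.scale_add_right scale_f add_0)
      also have "\<dots> = f2 i j (scR (1 - h) (snd x $$ (i, j)))"
        using ij by (simp add: f_scale scale_f)
      finally show "b \<in> f2 i j ` range (scR (1 - h))" by auto
    qed
  qed
qed

end

lemma (in tri_jordan_iso) split_exists:
  obtains h where "tri_jordan_iso_split scR scS n \<phi> h"
proof -
  obtain h where "h * h = h"
    and "\<And>i a. i < n \<Longrightarrow> a < n \<Longrightarrow> h * p i a = (if a = i then h else 0)"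
    and "\<And>i a. i < n \<Longrightarrow> a < n \<Longrightarrow> (1 - h) * p i a = (if a = n - 1 - i then 1 - h else 0)"
    by (rule betweenness_idempotents[of n p])
      (use n p_idem p_row_sum p_column_sum p_row_orth p_column_orth p_between in auto)
  then show thesis
    by (intro that[of h] tri_jordan_iso_split.intro tri_jordan_iso_split_axioms.intro tri_jordan_iso_axioms)
qed

section \<open>Normal forms of the components and assembly of the decomposition\<close>

context tri_jordan_iso_split
begin

text \<open>\<open>f1\<close> depends only on the part h a, so the chain lemma on h R describes it
  on all of R. The fact \<open>\<psi> 0 = 0\<close> is recorded because lifting applies \<psi> also
  to the zeros on and below the diagonal.\<close>

lemma f1_normal_form:
  obtains d d' \<psi> where
    "\<And>i. i < n \<Longrightarrow> d i \<in> range (scS h) \<and> d' i \<in> range (scS h) \<and> d i * d' i = scS h 1 \<and> d' i * d i = scS h 1"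
    and "summand_iso scR scS h \<psi>" and "\<psi> 0 = 0"
    and "\<And>i j a. i < j \<Longrightarrow> j < n \<Longrightarrow> f1 i j a = d i * \<psi> (scR h a) * d' j"
    and "\<And>a. \<psi> a \<in> range (scS h)"
proof -
  note R_unit = R.scale_range_unit[OF hh] and S_unit = S.scale_range_unit[OF hh]
  obtain d d' v where
    d: "\<And>i. i < n \<Longrightarrow> d i \<in> range (scS h) \<and> d' i \<in> range (scS h) \<and> d i * d' i = scS h 1 \<and> d' i * d i = scS h 1"
    and v: "v \<in> range (scS h)"
    and bij: "bij_betw (\<lambda>a. f1 0 1 a * v) (range (scR h)) (range (scS h))"
    and mult: "\<And>a b. a \<in> range (scR h) \<Longrightarrow> b \<in> range (scR h) \<Longrightarrow>
      f1 0 1 (a * b) * v = (f1 0 1 a * v) * (f1 0 1 b * v)"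
    and nf: "\<And>i j a. i < j \<Longrightarrow> j < n \<Longrightarrow> a \<in> range (scR h) \<Longrightarrow> f1 i j a = d i * (f1 0 1 a * v) * d' j"
    by (rule multiplicative_chain[of n "scR h 1" "range (scR h)" "scS h 1" "range (scS h)" "(*)" f1],
        (rule n R_unit S_unit mult.assoc f1_bij f1_mult; assumption)+) blast
  define \<psi> where "\<psi> a = f1 0 1 a * v" for a
  have n1: "(0::nat) < 1" "1 < n" using n by auto
  have "\<psi> (a + b) = \<psi> a + \<psi> b" "\<psi> (scR c a) = scS c (\<psi> a)" for a b c
    unfolding \<psi>_def f_add[OF n1] f_scale[OF n1] by (simp_all add: distrib_right S.scale_mult_left)
  then have "linear_bij scR scS h \<psi>"
    using bij unfolding linear_bij_def \<psi>_def[abs_def] by blast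
  then have "summand_iso scR scS h \<psi>"
    unfolding summand_iso_def using mult by (simp add: \<psi>_def)
  moreover have "f1 i j a = d i * \<psi> (scR h a) * d' j" if "i < j" "j < n" for i j a
    using nf[OF that, of "scR h a"] that by (simp add: \<psi>_def f_scale scale_f)
  moreover have "\<psi> 0 = 0"
    using f_scale(1)[OF n1, of 0 0] by (simp add: \<psi>_def)
  moreover have "\<psi> a \<in> range (scS h)" for a
    using S_unit(4)[OF f_range(1) v] by (simp add: \<psi>_def)
  ultimately show thesis using that[of d d' \<psi>] d by blast
qed

text \<open>The chain lemma is applied with the opposite multiplication of S, which exchanges the
  sides of the outer factors and makes \<psi> reverse products.\<close>

lemma f2_normal_form:
  obtains d d' \<psi> where
    "\<And>i. i < n \<Longrightarrow> d i \<in> range (scS (1 - h)) \<and> d' i \<in> range (scS (1 - h)) \<and>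
      d i * d' i = scS (1 - h) 1 \<and> d' i * d i = scS (1 - h) 1"
    and "summand_antiiso scR scS (1 - h) \<psi>" and "\<psi> 0 = 0"
    and "\<And>i j a. i < j \<Longrightarrow> j < n \<Longrightarrow> f2 i j a = d' j * \<psi> (scR (1 - h) a) * d i"
    and "\<And>a. \<psi> a \<in> range (scS (1 - h))"
proof -
  note R_unit = R.scale_range_unit[OF h'h'] and S_unit = S.scale_range_unit[OF h'h']
  obtain d d' v where
    d: "\<And>i. i < n \<Longrightarrow> d i \<in> range (scS (1 - h)) \<and> d' i \<in> range (scS (1 - h)) \<and>
      d' i * d i = scS (1 - h) 1 \<and> d i * d' i = scS (1 - h) 1"
    and v: "v \<in> range (scS (1 - h))"
    and bij: "bij_betw (\<lambda>a. v * f2 0 1 a) (range (scR (1 - h))) (range (scS (1 - h)))"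
    and mult: "\<And>a b. a \<in> range (scR (1 - h)) \<Longrightarrow> b \<in> range (scR (1 - h)) \<Longrightarrow>
      v * f2 0 1 (a * b) = (v * f2 0 1 b) * (v * f2 0 1 a)"
    and nf: "\<And>i j a. i < j \<Longrightarrow> j < n \<Longrightarrow> a \<in> range (scR (1 - h)) \<Longrightarrow>
      f2 i j a = d' j * ((v * f2 0 1 a) * d i)"
    by (rule multiplicative_chain[of n "scR (1 - h) 1" "range (scR (1 - h))" "scS (1 - h) 1"
          "range (scS (1 - h))" "\<lambda>x y. y * x" f2],
        (rule n R_unit S_unit mult.assoc[symmetric] f2_bij f2_mult; assumption)+) blast
  define \<psi> where "\<psi> a = v * f2 0 1 a" for a
  have n1: "(0::nat) < 1" "1 < n" using n by auto
  have "\<psi> (a + b) = \<psi> a + \<psi> b" "\<psi> (scR c a) = scS c (\<psi> a)" for a b c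
    unfolding \<psi>_def f_add[OF n1] f_scale[OF n1] by (simp_all add: distrib_left S.scale_mult_right)
  then have "linear_bij scR scS (1 - h) \<psi>"
    using bij unfolding linear_bij_def \<psi>_def[abs_def] by blast
  then have "summand_antiiso scR scS (1 - h) \<psi>"
    unfolding summand_antiiso_def using mult by (simp add: \<psi>_def)
  moreover have "f2 i j a = d' j * \<psi> (scR (1 - h) a) * d i" if "i < j" "j < n" for i j a
    using nf[OF that, of "scR (1 - h) a"] that by (simp add: \<psi>_def f_scale scale_f mult.assoc)
  moreover have "\<psi> 0 = 0"
    using f_scale(2)[OF n1, of 0 0] by (simp add: \<psi>_def)
  moreover have "\<psi> a \<in> range (scS (1 - h))" for a
    using S_unit(4)[OF v f_range(2)] by (simp add: \<psi>_def)
  ultimately show thesis using that[of d d' \<psi>] d by blast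
qed

lemma decomposition:
  obtains \<psi>1 \<psi>2 g2 where "summand_iso scR scS h \<psi>1" "summand_antiiso scR scS (1 - h) \<psi>2"
    "g2 \<in> Diag_units n"
    "\<And>x. x \<in> tri_carrier n \<Longrightarrow> \<phi> x = conj_by scS n g (conj_by scS n g2
       (tri_add (lift_iso \<psi>1 (tri_scale scR h x)) (lift_antiiso n \<psi>2 (tri_scale scR (1 - h) x))))"
proof -
  obtain d1 d1' \<psi>1 where d1: "\<And>i. i < n \<Longrightarrow> d1 i \<in> range (scS h) \<and> d1' i \<in> range (scS h) \<and>
      d1 i * d1' i = scS h 1 \<and> d1' i * d1 i = scS h 1"
    and \<psi>1: "summand_iso scR scS h \<psi>1" "\<psi>1 0 = 0"
    and nf1: "\<And>i j a. i < j \<Longrightarrow> j < n \<Longrightarrow> f1 i j a = d1 i * \<psi>1 (scR h a) * d1' j"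
    and r1: "\<And>a. \<psi>1 a \<in> range (scS h)"
    by (rule f1_normal_form) blast
  obtain d2 d2' \<psi>2 where d2: "\<And>i. i < n \<Longrightarrow> d2 i \<in> range (scS (1 - h)) \<and> d2' i \<in> range (scS (1 - h)) \<and>
      d2 i * d2' i = scS (1 - h) 1 \<and> d2' i * d2 i = scS (1 - h) 1"
    and \<psi>2: "summand_antiiso scR scS (1 - h) \<psi>2" "\<psi>2 0 = 0"
    and nf2: "\<And>i j a. i < j \<Longrightarrow> j < n \<Longrightarrow> f2 i j a = d2' j * \<psi>2 (scR (1 - h) a) * d2 i"
    and r2: "\<And>a. \<psi>2 a \<in> range (scS (1 - h))"
    by (rule f2_normal_form) blast
  note cross = S.scale_range_mult[OF hh']
  \<comment> \<open>One diagonal matrix has to serve both summands: its h S part is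
    \<open>d1\<close>, its (1 - h) S part is \<open>d2'\<close> at the reflected index. Products
    across the summands vanish, so \<open>D'\<close> inverts \<open>D\<close>.\<close>
  define D where "D s = d1 s + d2' (n - 1 - s)" for s
  define D' where "D' s = d1' s + d2 (n - 1 - s)" for s
  have rev: "n - 1 - s < n" if "s < n" for s using that by simp
  have DD: "D s * D' s = 1" "D' s * D s = 1" if s: "s < n" for s
  proof -
    have "d1 s * d2 (n - 1 - s) = 0" "d2' (n - 1 - s) * d1' s = 0"
      "d1' s * d2' (n - 1 - s) = 0" "d2 (n - 1 - s) * d1 s = 0"
      using d1[OF s] d2[OF rev[OF s]] by (simp_all add: cross)
    then show "D s * D' s = 1" "D' s * D s = 1"
      using d1[OF s] d2[OF rev[OF s]] by (simp_all add: D_def D'_def algebra_simps S.scale_split)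
  qed
  have conj: "D s * (a + b) * D' t = d1 s * a * d1' t + d2' (n - 1 - s) * b * d2 (n - 1 - t)"
    if "s < n" "t < n" "a \<in> range (scS h)" "b \<in> range (scS (1 - h))" for s t a b
  proof -
    have "d1 s * b = 0" "d2' (n - 1 - s) * a = 0" "a * d2 (n - 1 - t) = 0" "b * d1' t = 0"
      using d1[OF that(1)] d1[OF that(2)] d2[OF rev[OF that(1)]] d2[OF rev[OF that(2)]] that(3,4)
      by (simp_all add: cross)
    then show ?thesis by (simp add: D_def D'_def algebra_simps)
  qed
  define g2 where "g2 = mat_diag n D"
  define g2' where "g2' = mat_diag n D'"
  have g2: "g2 \<in> carrier_mat n n" "g2' \<in> carrier_mat n n" by (simp_all add: g2_def g2'_def)
  have inv: "g2 * g2' = 1\<^sub>m n" "g2' * g2 = 1\<^sub>m n"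
    unfolding g2_def g2'_def mat_diag_diag by (auto simp: mat_diag_def DD intro!: eq_matI)
  have "g2 \<in> Diag_units n"
    unfolding Diag_units_def g2_def using DD by blast
  moreover have "\<phi> x = conj_by scS n g (conj_by scS n g2
      (tri_add (lift_iso \<psi>1 (tri_scale scR h x)) (lift_antiiso n \<psi>2 (tri_scale scR (1 - h) x))))"
    (is "_ = conj_by scS n g (conj_by scS n g2 ?y)") if x: "x \<in> tri_carrier n" for x
  proof -
    have c: "fst x \<in> carrier_vec n" "snd x \<in> carrier_mat n n"
      and low: "\<And>i j. i < n \<Longrightarrow> j \<le> i \<Longrightarrow> snd x $$ (i, j) = 0"
      using x by (auto simp: tri_carrier_def)
    have y: "snd ?y $$ (s, t) = \<psi>1 (scR h (snd x $$ (s, t))) + \<psi>2 (scR (1 - h) (snd x $$ (n - 1 - t, n - 1 - s)))"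
      if "s < n" "t < n" for s t
      using that c by (simp add: tri_add_def lift_iso_def lift_antiiso_def tri_scale_def)
    have yd: "fst ?y $ s = fst (\<phi> x) $ s" if "s < n" for s
      using that c x by (simp add: diag_phi_split tri_add_def lift_iso_def lift_antiiso_def tri_scale_def)
    have yc: "?y \<in> tri_carrier n"
    proof -
      have "snd ?y $$ (s, t) = 0" if "s < n" "t \<le> s" for s t
        using that y[of s t] low[of s t] low[of "n - 1 - t" "n - 1 - s"] \<psi>1 \<psi>2 by simp
      moreover have "fst ?y \<in> carrier_vec n" "snd ?y \<in> carrier_mat n n"
        using c by (auto simp: tri_add_def lift_iso_def lift_antiiso_def tri_scale_def)
      ultimately show ?thesis by (simp add: tri_carrier_def case_prod_unfold)
    qed
    \<comment> \<open>The element between the two conjugations: its matrix is \<open>K x\<close>,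
      but its diagonal is taken from \<open>\<phi> x\<close>, since \<open>K x\<close> knows only
      the image in S.\<close>
    define z where "z = (tri_of n (\<lambda>s. fst (\<phi> x) $ s) (\<lambda>s t. K x $$ (s, t)) :: ('a, 'c) tri)"
    have zK: "full_mat scS n z = K x"
      using x upper_triangularD[OF K_upper[OF x]]
      by (intro eq_matI) (auto simp: full_mat_def z_def K_diag)
    have "z = conj_by scS n g2 ?y"
    proof (rule conj_by_eqI[OF _ yc g2 inv])
      show "full_mat scS n z = g2 * full_mat scS n ?y * g2'"
      proof (rule eq_matI)
        fix s t assume "s < dim_row (g2 * full_mat scS n ?y * g2')" "t < dim_col (g2 * full_mat scS n ?y * g2')"
        then have st: "s < n" "t < n" using g2 by auto
        have "(g2 * full_mat scS n ?y * g2') $$ (s, t) = D s * full_mat scS n ?y $$ (s, t) * D' t"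
          using st
          by (simp add: g2_def g2'_def mat_diag_mult_left[of _ n n] mat_diag_mult_right[of _ n n] del: index_mult_mat(1))
        also have "\<dots> = K x $$ (s, t)"
        proof -
          consider "s = t" | "t < s" | "s < t" by linarith
          then show ?thesis
          proof cases
            case 1
            then show ?thesis
              using st x yd[OF st(1)]
              by (simp add: full_mat_index K_diag S.scale_mult_left S.scale_mult_right DD)
          next
            case 2
            then show ?thesis
              using st yc upper_triangularD[OF K_upper[OF x], of t s]
              by (auto simp: full_mat_index tri_carrier_def)
          next
            case 3
            then have "n - 1 - t < n - 1 - s" "n - 1 - s < n" using st by auto
            then show ?thesis
              using 3 st K_offdiag[OF x 3 st(2)] conj[OF st r1 r2] nf1[OF 3 st(2)] nf2[of "n - 1 - t" "n - 1 - s"]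
              by (simp add: full_mat_index y)
          qed
        qed
        finally show "full_mat scS n z $$ (s, t) = (g2 * full_mat scS n ?y * g2') $$ (s, t)"
          by (simp add: zK)
      qed (use carrier_matD[OF g2(1)] carrier_matD[OF g2(2)] in \<open>simp_all add: full_mat_def\<close>)
    qed (use yd in \<open>simp_all add: z_def\<close>)
    moreover have "\<phi> x = conj_by scS n g z"
    proof (rule conj_by_eqI[OF phi_carrier[OF x] _ g_carrier g_g' g'_g])
      show "full_mat scS n (\<phi> x) = g * full_mat scS n z * g'"
        using K_F[of x] by (simp add: zK F_def)
    qed (simp_all add: z_def)
    ultimately show ?thesis by simp
  qed
  ultimately show thesis using that \<psi>1 \<psi>2 by blast
qed

end

theorem theorem2:
  fixes scR :: "'k :: {comm_ring, monoid_mult} \<Rightarrow> 'r :: {ring, monoid_mult} \<Rightarrow> 'r"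
    and scS :: "'k \<Rightarrow> 's :: {ring, monoid_mult} \<Rightarrow> 's"
    and n :: nat
    and \<phi> :: "('k, 'r) tri \<Rightarrow> ('k, 's) tri"
  assumes "unital_algebra scR" and "unital_algebra scS" and "n \<ge> 3"
    and no_killing_idempotent: "\<And>e. e * e = e \<Longrightarrow> (\<forall>a. scR e a = 0) \<Longrightarrow> e = 0"
    and "jordan_iso scR scS n \<phi>"
  shows "\<exists>h \<psi>1 \<psi>2 g1 g2.
    h * h = h \<and>
    summand_iso scR scS h \<psi>1 \<and>
    summand_antiiso scR scS (1 - h) \<psi>2 \<and>
    g1 \<in> UT n \<and> g2 \<in> Diag_units n \<and>
    (\<forall>x \<in> tri_carrier n.
       \<phi> x = conj_by scS n g1 (conj_by scS n g2
               (tri_add (lift_iso \<psi>1 (tri_scale scR h x))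
                        (lift_antiiso n \<psi>2 (tri_scale scR (1 - h) x)))))"
proof -
  interpret tri_jordan_iso scR scS n \<phi>
    using assms by (simp add: tri_jordan_iso_def tri_jordan_iso_axioms_def)
  obtain h where "tri_jordan_iso_split scR scS n \<phi> h" by (rule split_exists)
  then interpret tri_jordan_iso_split scR scS n \<phi> h .
  show ?thesis
    by (rule decomposition) (use hh g_UT(1) in blast)
qed

end
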